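(* Let $U\subseteq R_{2,1}$ be a basepoint free four-dimensional subspace such that $I_U$ has a unique linear first syzygy of bidegree $(0,1)$. Then $I_U$ has either one or two embedded prime ideals of the form $\langle s,t,L_i(u,v)\rangle$ with $L_i\in R_{0,1}$. Moreover, let $q(u,v)=\det A(u,v)=L_1(u,v)L_2(u,v)$ be the factorization into linear forms of the determinant of the matrix $A(u,v)$ described in the context. Then: (1) if $L_1=L_2$ (up to nonzero scalar), the only embedded prime of $I_U$ is $\langle s,t,L_1\rangle$; (2) if $L_1\neq L_2$ (up to nonzero scalar), $I_U$ has two embedded primes $\langle s,t,L_1\rangle$ and $\langle s,t,L_2\rangle$.
   Context: $k$ is an algebraically closed field and $R=k[s,t,u,v]$ is bigraded with $s,t$ of degree $(1,0)$ and $u,v$ of degree $(0,1)$; $R_{m,n}$ is the graded piece of bidegree $(m,n)$. $U=\mathrm{Span}\{p_0,p_1,p_2,p_3\}\subseteq R_{2,1}$ is a four-dimensional subspace and $I_U=\langle p_0,p_1,p_2,p_3\rangle$. $U$ is basepoint free if the $p_i$ have no common zero on $\mathbb{P}^1\times\mathbb{P}^1$, i.e. $\sqrt{I_U}=\langle s,t\rangle\cap\langle u,v\rangle$. A first syzygy of bidegree $(a,b)$ is a nonzero $(g_i)\in R_{a,b}^4$ with $\sum g_ip_i=0$; "unique" means unique up to nonzero scalar. The matrix $A$: under the hypothesis, after a linear change of the variables $s,t$, the space $U$ has a basis of one of the following forms, with $l_1,\dots,l_4\in R_{0,1}$: (Case 1) $s^2u,\ s^2v,\ stl_1+t^2l_2,\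 stl_3+t^2l_4$; or (Case 2) $stu,\ stv,\ s^2l_1+t^2l_2,\ s^2l_3+t^2l_4$. Then $A(u,v)=\begin{bmatrix}l_1&l_2\\ l_3&l_4\end{bmatrix}$, and its determinant $q(u,v)$ is nonzero. *)

theory Defs
  imports
    "HOL-Library.Poly_Mapping"
    "HOL-Computational_Algebra.Polynomial"
    "HOL-Analysis.Determinants"
begin

section \<open>The bigraded polynomial ring $k[s,t,u,v]$\<close>

datatype var = S | T | U | V

text \<open>A polynomial is a finitely supported map from exponent vectors to coefficients; its ring
  structure is the convolution product of \<^theory>\<open>HOL-Library.Poly_Mapping\<close>.\<close>

type_synonym 'k pol = "(var \<Rightarrow>\<^sub>0 nat) \<Rightarrow>\<^sub>0 'k"

definition Const :: "'k \<Rightarrow> 'k::field pol" where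
  "Const c = Poly_Mapping.single 0 c"

definition Var :: "var \<Rightarrow> 'k::field pol" where
  "Var x = Poly_Mapping.single (Poly_Mapping.single x 1) 1"

definition bigraded :: "nat \<Rightarrow> nat \<Rightarrow> 'k::field pol set" where
  "bigraded m n =
     {p. \<forall>e \<in> Poly_Mapping.keys p.
           Poly_Mapping.lookup e S + Poly_Mapping.lookup e T = m \<and>
           Poly_Mapping.lookup e U + Poly_Mapping.lookup e V = n}"

definition eval_pol :: "(var \<Rightarrow> 'k) \<Rightarrow> 'k::field pol \<Rightarrow> 'k" where
  "eval_pol a p = (\<Sum>e \<in> Poly_Mapping.keys p.
     Poly_Mapping.lookup p e * (\<Prod>x \<in> Poly_Mapping.keys e. a x ^ Poly_Mapping.lookup e x))"

definition kscale :: "'k \<Rightarrow> 'k::field pol \<Rightarrow> 'k pol" where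
  "kscale c p = Const c * p"

interpretation kspace: vector_space "kscale :: 'k \<Rightarrow> 'k::field pol \<Rightarrow> 'k pol"
  by unfold_locales
    (simp_all add: kscale_def Const_def algebra_simps single_add mult_single flip: mult.assoc)

definition associated_up_to_scalar :: "'k::field pol \<Rightarrow> 'k pol \<Rightarrow> bool" where
  "associated_up_to_scalar p q \<longleftrightarrow> (\<exists>c. c \<noteq> 0 \<and> p = kscale c q)"


section \<open>Ideals, associated and embedded primes\<close>

text \<open>Ideals of a commutative ring are its submodules, so that
  \<open>ideal.subspace I\<close> says that \<open>I\<close> is an ideal and \<open>ideal.span B\<close> is the ideal generated by \<open>B\<close>.\<close>

interpretation ideal: module "(*) :: 'a \<Rightarrow> 'a \<Rightarrow> 'a::comm_ring_1"
  by unfold_locales (simp_all add: algebra_simps)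

definition prime_ideal :: "'a::comm_ring_1 set \<Rightarrow> bool" where
  "prime_ideal P \<longleftrightarrow> ideal.subspace P \<and> P \<noteq> UNIV \<and> (\<forall>a b. a * b \<in> P \<longrightarrow> a \<in> P \<or> b \<in> P)"

text \<open>As usual, the associated primes of an ideal \<open>I\<close> are those of the module \<open>R/I\<close>, that is,
  the prime annihilators \<open>(I : f)\<close> of residue classes; the embedded ones are those that are not
  minimal among them.\<close>

definition associated_prime :: "'a::comm_ring_1 set \<Rightarrow> 'a set \<Rightarrow> bool" where
  "associated_prime I P \<longleftrightarrow> prime_ideal P \<and> (\<exists>f. P = {g. g * f \<in> I})"

definition embedded_prime :: "'a::comm_ring_1 set \<Rightarrow> 'a set \<Rightarrow> bool" where
  "embedded_prime I P \<longleftrightarrow> associated_prime I P \<and> (\<exists>Q. associated_prime I Q \<and> Q \<subset> P)"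

definition st_prime :: "'k::field pol \<Rightarrow> 'k pol set" where
  "st_prime L = ideal.span {Var S, Var T, L}"


section \<open>Four-dimensional spaces of forms\<close>

text \<open>Families \<open>p\<^sub>0, \<dots>, p\<^sub>3\<close> are functions on \<^typ>\<open>nat\<close>; only their values below 4 matter.\<close>

definition basepoint_free :: "(nat \<Rightarrow> 'k::field pol) \<Rightarrow> bool" where
  "basepoint_free p \<longleftrightarrow>
     \<not> (\<exists>a. (a S, a T) \<noteq> (0, 0) \<and> (a U, a V) \<noteq> (0, 0) \<and> (\<forall>i<4. eval_pol a (p i) = 0))"

definition first_syzygy :: "(nat \<Rightarrow> 'k::field pol) \<Rightarrow> nat \<Rightarrow> nat \<Rightarrow> (nat \<Rightarrow> 'k pol) \<Rightarrow> bool" where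
  "first_syzygy p a b g \<longleftrightarrow>
     (\<forall>i<4. g i \<in> bigraded a b) \<and> (\<exists>i<4. g i \<noteq> 0) \<and> (\<Sum>i<4. g i * p i) = 0"

definition unique_first_syzygy :: "(nat \<Rightarrow> 'k::field pol) \<Rightarrow> nat \<Rightarrow> nat \<Rightarrow> bool" where
  "unique_first_syzygy p a b \<longleftrightarrow>
     (\<exists>g. first_syzygy p a b g \<and>
       (\<forall>g'. first_syzygy p a b g' \<longrightarrow> (\<exists>c. c \<noteq> 0 \<and> (\<forall>i<4. g' i = kscale c (g i)))))"

text \<open>\<open>A\<close> is a matrix of the space \<open>W\<close> if its entries \<open>l\<^sub>1, l\<^sub>2\<close> (first row) and
  \<open>l\<^sub>3, l\<^sub>4\<close> (second row) are the coefficients of a basis of \<open>W\<close> in one of the two normal forms.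
  The linear change of variables is expressed by passing to new variables \<open>s' = as + bt\<close>,
  \<open>t' = cs + dt\<close> with \<open>ad - bc \<noteq> 0\<close>, in which the normal form is written.\<close>

definition normal_form_matrix :: "'k::field pol set \<Rightarrow> 'k pol ^ 2 ^ 2 \<Rightarrow> bool" where
  "normal_form_matrix W A \<longleftrightarrow>
     (\<forall>i j. A $ i $ j \<in> bigraded 0 1) \<and>
     (\<exists>a b c d s' t' B.
        a * d - b * c \<noteq> 0 \<and>
        s' = kscale a (Var S) + kscale b (Var T) \<and>
        t' = kscale c (Var S) + kscale d (Var T) \<and>
        (B = [s'\<^sup>2 * Var U, s'\<^sup>2 * Var V,
              s' * t' * A $ 1 $ 1 + t'\<^sup>2 * A $ 1 $ 2,
              s' * t' * A $ 2 $ 1 + t'\<^sup>2 * A $ 2 $ 2] \<or>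
         B = [s' * t' * Var U, s' * t' * Var V,
              s'\<^sup>2 * A $ 1 $ 1 + t'\<^sup>2 * A $ 1 $ 2,
              s'\<^sup>2 * A $ 2 $ 1 + t'\<^sup>2 * A $ 2 $ 2]) \<and>
        distinct B \<and> kspace.independent (set B) \<and> kspace.span (set B) = W)"

end

theory Submission
  imports Defs
begin

text \<open>A syzygy of bidegree \<open>(0, 1)\<close> has the form \<open>v P = u Q\<close> with \<open>P, Q\<close> in the span of the \<open>p\<^sub>i\<close>, so
  \<open>P = h u\<close> and \<open>Q = h v\<close> for a quadratic form \<open>h\<close> in \<open>s, t\<close>; factoring \<open>h\<close> yields the normal forms.
  Put \<open>K = k[u, v]\<close> and \<open>m = \<langle>u, v\<rangle>\<close>. Basepoint freeness makes the entries of each relevant column of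
  \<open>A\<close> generate \<open>m\<close>, so that \<open>I\<close> agrees with \<open>m R\<close> in \<open>(s, t)\<close>-degrees at least 3, vanishes in degrees
  0 and 1, and \<open>(R/I)\<^sub>2 = K/m \<oplus> coker A\<close>. An associated prime \<open>(I : x)\<close> contains \<open>s, t\<close> or contains \<open>m\<close>,
  as \<open>I\<close> contains \<open>s\<^sup>3 m\<close> and \<open>t\<^sup>3 m\<close>. In the second case it is \<open>m R\<close>. In the first case it is either \<open>\<langle>s, t\<rangle>\<close>
  or \<open>\<langle>s, t\<rangle>\<close> plus an annihilator in \<open>coker A\<close>; since \<open>det A = L\<^sub>1 L\<^sub>2\<close> with \<open>L\<^sub>1, L\<^sub>2\<close> prime, Cramer's rule
  shows that the prime annihilators are \<open>\<langle>L\<^sub>1\<rangle>\<close> and \<open>\<langle>L\<^sub>2\<rangle>\<close>.\<close>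

text \<open>Read from left to right, this rule undoes \<open>mult.assoc\<close>, so that \<open>algebra_simps\<close> would loop.\<close>

declare ideal.scale_scale [simp del]

section \<open>Unital ring homomorphisms and associated primes\<close>

text \<open>Colon ideals cannot be read off from generators. The ideal theory is therefore done in
  \<open>K[t'][s']\<close>, realized by iterated univariate polynomials, for an ideal
  \<open>J\<close> defined by a membership test on coefficients; that \<open>J\<close> is generated
  by the normal form is a separate computation. The isomorphism \<open>pol_of_bipoly s' t'\<close>
  absorbs the linear change of variables, so that both normal forms become instances of one setting
  and differ in two pairs of exponents. Case 1 yields independence of the second column of
  \<open>A\<close> alone, and the shared argument rests on that column: no \<open>L_i\<close>
  divides both of its entries, so nothing nonzero in the cokernel is killed by \<open>m\<close>. The
  primes \<open>\<langle>s, t\<rangle>\<close> and \<open>m R\<close> do not contain each other, and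
  both \<open>\<langle>s, t, L_i\<rangle>\<close> lie strictly above the first; hence exactly the
  latter are embedded. Uniqueness of the syzygy enters through \<open>det A \<noteq> 0\<close>,
  without which the factors \<open>L_i\<close> could not be prime elements. Algebraic closure enters
  through the factorization of binary quadratic forms, once for \<open>h\<close> and once for
  \<open>det A\<close>.\<close>

definition unital_hom :: "('a::comm_ring_1 \<Rightarrow> 'b::comm_ring_1) \<Rightarrow> bool" where
  "unital_hom f \<longleftrightarrow> f 1 = 1 \<and> (\<forall>x y. f (x + y) = f x + f y) \<and> (\<forall>x y. f (x * y) = f x * f y)"

lemma unital_homD:
  assumes "unital_hom f"
  shows "f 1 = 1" "f (x + y) = f x + f y" "f (x * y) = f x * f y"
    "f 0 = 0" "f (- x) = - f x" "f (x - y) = f x - f y"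
proof -
  show 1: "f 1 = 1" "\<And>x y. f (x + y) = f x + f y" "\<And>x y. f (x * y) = f x * f y"
    using assms by (auto simp: unital_hom_def)
  show 0: "f 0 = 0"
    using 1(2)[of 0 0] by simp
  show neg: "\<And>x. f (- x) = - f x"
    using 1(2) 0 by (metis add.right_inverse add_eq_0_iff)
  show "f (x - y) = f x - f y"
    using 1(2)[of x "- y"] neg[of y] by simp
qed

lemma unital_hom_power: "unital_hom f \<Longrightarrow> f (x ^ n) = f x ^ n"
  by (induction n) (simp_all add: unital_homD)

lemma unital_hom_comp: "unital_hom f \<Longrightarrow> unital_hom g \<Longrightarrow> unital_hom (\<lambda>x. f (g x))"
  by (simp add: unital_hom_def)

lemma ideal_subspaceI:
  assumes "0 \<in> I" "\<And>x y. x \<in> I \<Longrightarrow> y \<in> I \<Longrightarrow> x + y \<in> I" "\<And>c x. x \<in> I \<Longrightarrow> c * x \<in> I"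
  shows "ideal.subspace I"
  using assms by (auto simp: ideal.subspace_def)

lemma ideal_subspace_mult_right: "ideal.subspace I \<Longrightarrow> x \<in> I \<Longrightarrow> x * c \<in> I"
  using ideal.subspace_scale[of I x c] by (simp add: mult.commute)

lemma prime_idealD:
  assumes "prime_ideal P"
  shows "ideal.subspace P" "1 \<notin> P" "a * b \<in> P \<Longrightarrow> a \<in> P \<or> b \<in> P"
proof -
  show P: "ideal.subspace P" "a * b \<in> P \<Longrightarrow> a \<in> P \<or> b \<in> P"
    using assms by (auto simp: prime_ideal_def)
  show "1 \<notin> P"
  proof
    assume "1 \<in> P"
    then have "x \<in> P" for x
      using ideal.subspace_scale[OF P(1), of 1 x] by simp
    then show False
      using assms by (auto simp: prime_ideal_def)
  qed
qed

lemma prime_idealI: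
  assumes "ideal.subspace P" "1 \<notin> P" "\<And>a b. a * b \<in> P \<Longrightarrow> a \<in> P \<or> b \<in> P"
  shows "prime_ideal P"
  using assms by (auto simp: prime_ideal_def)

lemma prime_ideal_vimage:
  assumes f: "unital_hom f" and P: "prime_ideal P"
  shows "prime_ideal (f -` P)"
proof (rule prime_idealI)
  show "ideal.subspace (f -` P)"
    using prime_idealD(1)[OF P]
    by (intro ideal_subspaceI)
       (auto simp: unital_homD[OF f] ideal.subspace_0 ideal.subspace_add ideal.subspace_scale)
  show "1 \<notin> f -` P"
    using prime_idealD(2)[OF P] by (simp add: unital_homD[OF f])
  show "a \<in> f -` P \<or> b \<in> f -` P" if "a * b \<in> f -` P" for a b
    using that prime_idealD(3)[OF P] by (simp add: unital_homD[OF f])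
qed

lemma prime_ideal_zero: "prime_ideal {0 :: 'a::idom}"
  by (rule prime_idealI) (auto intro!: ideal_subspaceI)

lemma prime_ideal_multiples:
  fixes p :: "'a::idom"
  assumes "prime_elem p"
  shows "prime_ideal {x. p dvd x}"
  using assms prime_elem_not_unit[OF assms]
  by (intro prime_idealI ideal_subspaceI) (auto dest: prime_elem_dvd_multD)

lemma ideal_span_image:
  assumes f: "unital_hom f" and "surj f"
  shows "ideal.span (f ` B) = f ` ideal.span B"
proof
  have "ideal.subspace (f ` ideal.span B)"
  proof (rule ideal_subspaceI)
    show "0 \<in> f ` ideal.span B"
      using unital_homD(4)[OF f] ideal.span_zero by (metis image_eqI)
    show "x + y \<in> f ` ideal.span B" if "x \<in> f ` ideal.span B" "y \<in> f ` ideal.span B" for x y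
      using that by (auto simp flip: unital_homD(2)[OF f] intro: ideal.span_add)
    show "c * x \<in> f ` ideal.span B" if "x \<in> f ` ideal.span B" for c x
    proof -
      from \<open>surj f\<close> obtain d where "c = f d" by auto
      with that show ?thesis
        by (auto simp flip: unital_homD(3)[OF f] intro: ideal.span_scale)
    qed
  qed
  then show "ideal.span (f ` B) \<subseteq> f ` ideal.span B"
    by (intro ideal.span_minimal image_mono ideal.span_superset)
  have "f x \<in> ideal.span (f ` B)" if "x \<in> ideal.span B" for x
    using that
    by (induction rule: ideal.span_induct_alt)
       (auto simp: unital_homD[OF f] ideal.span_zero
         intro: ideal.span_add ideal.span_scale ideal.span_base)
  then show "f ` ideal.span B \<subseteq> ideal.span (f ` B)"
    by auto
qed

lemma prime_ideal_image_iff: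
  assumes f: "unital_hom f" and "bij f"
  shows "prime_ideal (f ` P) \<longleftrightarrow> prime_ideal P"
proof
  have inv: "f -` f ` P = P" "f (inv f y) = y" for y
    using \<open>bij f\<close> by (auto simp: bij_def inj_vimage_image_eq surj_f_inv_f)
  show "prime_ideal P" if "prime_ideal (f ` P)"
    using prime_ideal_vimage[OF f that] inv by simp
  have "unital_hom (inv f)"
  proof -
    have "inv f (f x) = x" for x
      using \<open>bij f\<close> by (simp add: bij_def)
    then show ?thesis
      unfolding unital_hom_def by (metis inv(2) unital_homD(1-3)[OF f])
  qed
  moreover have "f ` P = inv f -` P"
    using \<open>bij f\<close> by (simp add: bij_vimage_eq_inv_image bij_imp_bij_inv inv_inv_eq)
  ultimately show "prime_ideal (f ` P)" if "prime_ideal P"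
    using that by (simp add: prime_ideal_vimage)
qed

lemma associated_prime_image_iff:
  assumes f: "unital_hom f" and "bij f"
  shows "associated_prime (f ` I) (f ` P) \<longleftrightarrow> associated_prime I P"
proof -
  have "(f ` P = {g. g * f x \<in> f ` I}) \<longleftrightarrow> (P = {g. g * x \<in> I})" for x
  proof -
    have "f g * f x \<in> f ` I \<longleftrightarrow> g * x \<in> I" for g
      using \<open>bij f\<close> by (simp add: bij_def inj_image_mem_iff flip: unital_homD(3)[OF f])
    then have "{g. g * f x \<in> f ` I} = f ` {g. g * x \<in> I}"
      using bij_pointE[OF \<open>bij f\<close>] by (auto simp: image_iff) metis
    with \<open>bij f\<close> show ?thesis
      by (simp add: bij_def inj_image_eq_iff)
  qed
  moreover have "(\<exists>y. f ` P = {g. g * y \<in> f ` I}) \<longleftrightarrow> (\<exists>x. f ` P = {g. g * f x \<in> f ` I})"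
    using \<open>bij f\<close> by (metis bij_pointE)
  ultimately show ?thesis
    by (simp add: associated_prime_def prime_ideal_image_iff[OF assms])
qed

lemma embedded_primes_image:
  assumes f: "unital_hom f" and "bij f"
  shows "{P. embedded_prime (f ` I) P} = (`) f ` {P. embedded_prime I P}"
proof -
  have ex: "\<exists>Q'. Q = f ` Q'" for Q
    using \<open>bij f\<close> by (metis bij_def surj_image_vimage_eq)
  have "embedded_prime (f ` I) (f ` P) \<longleftrightarrow> embedded_prime I P" for P
  proof -
    have "(\<exists>Q. associated_prime (f ` I) Q \<and> Q \<subset> f ` P) \<longleftrightarrow>
        (\<exists>Q. associated_prime (f ` I) (f ` Q) \<and> f ` Q \<subset> f ` P)"
      using ex by metis
    moreover have "f ` Q \<subset> f ` P \<longleftrightarrow> Q \<subset> P" for Q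
      using \<open>bij f\<close> by (simp add: bij_def inj_image_subset_iff psubset_eq inj_image_eq_iff)
    ultimately show ?thesis
      by (simp add: embedded_prime_def associated_prime_image_iff[OF assms])
  qed
  then show ?thesis
    using ex by (auto simp: image_iff) metis
qed

text \<open>The argument of Gauss's lemma: in the coefficient at the sum of the two least degrees
  that escape \<open>M\<close>, all terms but one lie in \<open>M\<close>. Applied twice, it makes
  the extension of \<open>m\<close> to two variables prime.\<close>

lemma prime_ideal_coeffs:
  fixes M :: "'a::comm_ring_1 set"
  assumes M: "prime_ideal M"
  shows "prime_ideal {p :: 'a poly. \<forall>i. coeff p i \<in> M}" (is "prime_ideal ?P")
proof (rule prime_idealI)
  note sub = prime_idealD(1)[OF M]
  show "ideal.subspace ?P"
    by (rule ideal_subspaceI)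
       (auto simp: coeff_mult intro!: ideal.subspace_0 ideal.subspace_add ideal.subspace_sum
         ideal.subspace_scale sub)
  show "1 \<notin> ?P"
    using prime_idealD(2)[OF M] by (auto intro!: exI[of _ 0])
  fix p q :: "'a poly"
  assume pq: "p * q \<in> ?P"
  show "p \<in> ?P \<or> q \<in> ?P"
  proof (rule ccontr)
    assume "\<not> ?thesis"
    then have ex: "\<exists>i. coeff p i \<notin> M" "\<exists>j. coeff q j \<notin> M" by auto
    define i where "i = (LEAST i. coeff p i \<notin> M)"
    define j where "j = (LEAST j. coeff q j \<notin> M)"
    have i: "coeff p i \<notin> M" "\<And>k. k < i \<Longrightarrow> coeff p k \<in> M"
      unfolding i_def by (fact LeastI_ex[OF ex(1)], use not_less_Least in blast)
    have j: "coeff q j \<notin> M" "\<And>k. k < j \<Longrightarrow> coeff q k \<in> M"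
      unfolding j_def by (fact LeastI_ex[OF ex(2)], use not_less_Least in blast)
    have "coeff (p * q) (i + j) =
        coeff p i * coeff q j + (\<Sum>k\<in>{..i + j} - {i}. coeff p k * coeff q (i + j - k))"
      by (simp add: coeff_mult sum.remove[of _ i])
    moreover have "(\<Sum>k\<in>{..i + j} - {i}. coeff p k * coeff q (i + j - k)) \<in> M"
    proof (rule ideal.subspace_sum[OF sub])
      fix k assume k: "k \<in> {..i + j} - {i}"
      show "coeff p k * coeff q (i + j - k) \<in> M"
      proof (cases "k < i")
        case True
        then show ?thesis
          using i(2) sub by (simp add: ideal_subspace_mult_right)
      next
        case False
        then have "i + j - k < j"
          using k by auto
        then show ?thesis
          using j(2) sub by (simp add: ideal.subspace_scale)
      qed
    qed
    moreover have "coeff (p * q) (i + j) \<in> M"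
      using pq by blast
    ultimately have "coeff p i * coeff q j \<in> M"
      using ideal.subspace_diff[OF sub] by (metis add_diff_cancel_right')
    then show False
      using i(1) j(1) prime_idealD(3)[OF M] by blast
  qed
qed


section \<open>Coefficients of polynomials in two variables\<close>

abbreviation bicoeff :: "'a::zero poly poly \<Rightarrow> nat \<Rightarrow> nat \<Rightarrow> 'a" where
  "bicoeff x i j \<equiv> coeff (coeff x i) j"

text \<open>This is \<open>c s^i t^j\<close> with \<open>s\<close> the outer variable. The same
  notation serves one level below, where the coefficient ring is itself \<open>k[v][u]\<close> and
  \<open>u\<close>, \<open>v\<close> take the places of \<open>s\<close>, \<open>t\<close>.\<close>

definition bimonom :: "nat \<Rightarrow> nat \<Rightarrow> 'a::comm_ring_1 \<Rightarrow> 'a poly poly" where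
  "bimonom i j c = monom (monom c j) i"

lemma bicoeff_bimonom: "bicoeff (bimonom a b c) i j = (if i = a \<and> j = b then c else 0)"
  by (simp add: bimonom_def)

lemma bicoeff_mult:
  "bicoeff (x * y) i j = (\<Sum>a\<le>i. \<Sum>b\<le>j. bicoeff x a b * bicoeff y (i - a) (j - b))"
  by (simp add: coeff_mult coeff_sum)

lemma bicoeff_bimonom_mult:
  "bicoeff (bimonom a b c * x) i j = (if a \<le> i \<and> b \<le> j then c * bicoeff x (i - a) (j - b) else 0)"
  by (simp add: bimonom_def coeff_monom_mult)

lemma bimonom_mult: "bimonom a b c * bimonom i j d = bimonom (a + i) (b + j) (c * d)"
  by (simp add: bimonom_def mult_monom)

lemma bimonom_add: "bimonom i j c + bimonom i j d = bimonom i j (c + d)"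
  by (simp add: bimonom_def add_monom)

lemma bimonom_0 [simp]: "bimonom i j 0 = 0"
  by (simp add: bimonom_def)

lemma bipoly_as_sum_of_bimonoms:
  "(\<Sum>i\<le>degree x. \<Sum>j\<le>degree (coeff x i). bimonom i j (bicoeff x i j)) = x"
proof -
  have "(\<Sum>j\<in>A. bimonom i j (c j)) = monom (\<Sum>j\<in>A. monom (c j) j) i" for A i and c :: "nat \<Rightarrow> 'a"
    by (induction A rule: infinite_finite_induct) (simp_all add: bimonom_def add_monom)
  then show ?thesis
    by (simp add: poly_as_sum_of_monoms)
qed

lemma unital_hom_bicoeff_0: "unital_hom (\<lambda>x :: 'a::comm_ring_1 poly poly. bicoeff x 0 0)"
  by (simp add: unital_hom_def bicoeff_mult)

text \<open>Every term except the constant one is a multiple of \<open>s\<close> or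
  \<open>t\<close>. This describes the primes \<open>\<langle>s, t, L\<rangle>\<close>; the instance
  \<open>L = 0\<close> describes the ideal of the two variables.\<close>

lemma ideal_span_bimonom:
  "ideal.span {bimonom 1 0 1, bimonom 0 1 1, bimonom 0 0 (L :: 'a::comm_ring_1)} =
     {x. L dvd bicoeff x 0 0}" (is "?I = _")
proof
  have "ideal.subspace {x :: 'a poly poly. L dvd bicoeff x 0 0}"
    by (rule ideal_subspaceI) (simp_all add: bicoeff_mult)
  moreover have "{bimonom 1 0 1, bimonom 0 1 1, bimonom 0 0 L} \<subseteq> {x :: 'a poly poly. L dvd bicoeff x 0 0}"
    by (simp add: bicoeff_bimonom)
  ultimately show "?I \<subseteq> {x. L dvd bicoeff x 0 0}"
    by (rule ideal.span_minimal[rotated])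
  have s: "bimonom 1 0 1 \<in> ?I" "bimonom 0 1 1 \<in> ?I" "bimonom 0 0 L \<in> ?I"
    by (auto intro: ideal.span_base)
  show "{x. L dvd bicoeff x 0 0} \<subseteq> ?I"
  proof
    fix x assume "x \<in> {x. L dvd bicoeff x 0 0}"
    then obtain c where c: "bicoeff x 0 0 = c * L" by (metis dvdE mult.commute mem_Collect_eq)
    have "bimonom i j (bicoeff x i j) \<in> ?I" for i j
    proof -
      consider "i > 0" | "j > 0" | "i = 0" "j = 0" by blast
      then show ?thesis
      proof cases
        case 1
        then have "bimonom i j (bicoeff x i j) = bimonom (i - 1) j (bicoeff x i j) * bimonom 1 0 1"
          by (simp add: bimonom_mult)
        then show ?thesis using s by (simp add: ideal.span_scale)
      next
        case 2
        then have "bimonom i j (bicoeff x i j) = bimonom i (j - 1) (bicoeff x i j) * bimonom 0 1 1"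
          by (simp add: bimonom_mult)
        then show ?thesis using s by (simp add: ideal.span_scale)
      next
        case 3
        then have "bimonom i j (bicoeff x i j) = bimonom 0 0 c * bimonom 0 0 L"
          by (simp add: bimonom_mult c)
        then show ?thesis using s by (simp add: ideal.span_scale)
      qed
    qed
    then have "(\<Sum>i\<le>degree x. \<Sum>j\<le>degree (coeff x i). bimonom i j (bicoeff x i j)) \<in> ?I"
      by (intro ideal.span_sum)
    then show "x \<in> ?I"
      by (simp only: bipoly_as_sum_of_bimonoms)
  qed
qed


section \<open>The associated primes of the ideal\<close>

text \<open>The exponents \<open>(i1, j1)\<close> and \<open>(i2, j2)\<close> are those of the two quadratic monomials
  multiplying the columns of \<open>A\<close> in a normal form; the third one multiplies \<open>u\<close> and \<open>v\<close>.\<close>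

locale form_ideal =
  fixes l1 l2 l3 l4 L1 L2 :: "'a::idom" and m :: "'a set" and i1 j1 i2 j2 :: nat
  assumes prime_m: "prime_ideal m"
    and l_in_m: "l1 \<in> m" "l2 \<in> m" "l3 \<in> m" "l4 \<in> m"
    and L_in_m: "L1 \<in> m" "L2 \<in> m"
    and prime_L: "prime_elem L1" "prime_elem L2"
    and det_eq: "l1 * l4 - l2 * l3 = L1 * L2"
    and not_dvd: "\<not> (L1 dvd l2 \<and> L1 dvd l4)" "\<not> (L2 dvd l2 \<and> L2 dvd l4)"
    and exponents: "i1 + j1 = 2" "i2 + j2 = 2" "(i1, j1) \<noteq> (i2, j2)"
begin

definition row_span :: "'a \<Rightarrow> 'a \<Rightarrow> bool" where
  "row_span y z \<longleftrightarrow> (\<exists>a b. y = a * l1 + b * l3 \<and> z = a * l2 + b * l4)"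

text \<open>In degree 2 the two coefficients belonging to the columns of \<open>A\<close> must form
  a combination of its rows, that is, vanish in the cokernel; the third coefficient is only required
  to lie in \<open>m\<close>, and the same holds for all coefficients of degree at least 3.\<close>

definition J :: "'a poly poly set" where
  "J = {x. (\<forall>i j. i + j < 2 \<longrightarrow> bicoeff x i j = 0) \<and> (\<forall>i j. bicoeff x i j \<in> m) \<and>
     row_span (bicoeff x i1 j1) (bicoeff x i2 j2)}"

lemmas sub_m = prime_idealD(1)[OF prime_m]

lemma det_nonzero: "L1 * L2 \<noteq> 0"
  using prime_L by (auto simp: prime_elem_def)

text \<open>Cramer's rule: multiplication by the adjugate matrix detects the row span.\<close>

lemma row_span_iff:
  "row_span y z \<longleftrightarrow> L1 * L2 dvd y * l4 - z * l3 \<and> L1 * L2 dvd z * l1 - y * l2"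
proof
  assume "row_span y z"
  then obtain a b where yz: "y = a * l1 + b * l3" "z = a * l2 + b * l4"
    unfolding row_span_def by blast
  have "y * l4 - z * l3 = L1 * L2 * a" "z * l1 - y * l2 = L1 * L2 * b"
    unfolding det_eq[symmetric] yz by algebra+
  then show "L1 * L2 dvd y * l4 - z * l3 \<and> L1 * L2 dvd z * l1 - y * l2"
    by simp
next
  assume "L1 * L2 dvd y * l4 - z * l3 \<and> L1 * L2 dvd z * l1 - y * l2"
  then have dvd: "L1 * L2 dvd y * l4 - z * l3" "L1 * L2 dvd z * l1 - y * l2"
    by simp_all
  from dvd(1) obtain a where a: "y * l4 - z * l3 = L1 * L2 * a" ..
  from dvd(2) obtain b where b: "z * l1 - y * l2 = L1 * L2 * b" ..
  note ab = a b
  have "L1 * L2 * (a * l1 + b * l3) = (L1 * L2 * a) * l1 + (L1 * L2 * b) * l3"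
    by (simp add: algebra_simps)
  also have "\<dots> = L1 * L2 * y"
    unfolding ab[symmetric] unfolding det_eq[symmetric] by algebra
  finally have y: "y = a * l1 + b * l3"
    using det_nonzero by simp
  have "L1 * L2 * (a * l2 + b * l4) = (L1 * L2 * a) * l2 + (L1 * L2 * b) * l4"
    by (simp add: algebra_simps)
  also have "\<dots> = L1 * L2 * z"
    unfolding ab[symmetric] unfolding det_eq[symmetric] by algebra
  finally have z: "z = a * l2 + b * l4"
    using det_nonzero by simp
  from y z show "row_span y z"
    by (auto simp: row_span_def)
qed

lemma row_span_0: "row_span 0 0"
  by (simp add: row_span_iff)

lemma row_span_add:
  assumes "row_span y z" "row_span y' z'"
  shows "row_span (y + y') (z + z')"
proof -
  have "(y + y') * l4 - (z + z') * l3 = (y * l4 - z * l3) + (y' * l4 - z' * l3)"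
    "(z + z') * l1 - (y + y') * l2 = (z * l1 - y * l2) + (z' * l1 - y' * l2)"
    by (simp_all add: algebra_simps)
  then show ?thesis
    using assms unfolding row_span_iff by (simp only: dvd_add)
qed

lemma row_span_scale_iff:
  "row_span (c * y) (c * z) \<longleftrightarrow>
     L1 * L2 dvd c * (y * l4 - z * l3) \<and> L1 * L2 dvd c * (z * l1 - y * l2)"
  by (simp add: row_span_iff algebra_simps)

lemma row_span_scale: "row_span y z \<Longrightarrow> row_span (c * y) (c * z)"
  unfolding row_span_scale_iff row_span_iff[of y z] by simp

text \<open>In the lowest degree of \<open>x\<close> only the constant term of \<open>g\<close>
  contributes, so \<open>g\<close> acts there as a scalar from the coefficient ring.\<close>

lemma bicoeff_mult_degree_2:
  fixes x g :: "'a poly poly"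
  assumes "\<And>i j. i + j < 2 \<Longrightarrow> bicoeff x i j = 0" and "i + j = 2"
  shows "bicoeff (g * x) i j = bicoeff g 0 0 * bicoeff x i j"
proof -
  have "bicoeff x 0 0 = 0" "bicoeff x 1 0 = 0" "bicoeff x 0 1 = 0"
    using assms(1) by auto
  moreover have "i = 0 \<and> j = 2 \<or> i = 1 \<and> j = 1 \<or> i = 2 \<and> j = 0"
    using assms(2) by auto
  ultimately show ?thesis
    by (auto simp: bicoeff_mult numeral_2_eq_2)
qed

lemma bicoeff_mult_degree_1:
  fixes x g :: "'a poly poly"
  assumes "bicoeff x 0 0 = 0"
  shows "bicoeff (g * x) 0 0 = 0" "bicoeff (g * x) (Suc 0) 0 = bicoeff g 0 0 * bicoeff x (Suc 0) 0"
    "bicoeff (g * x) 0 (Suc 0) = bicoeff g 0 0 * bicoeff x 0 (Suc 0)"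
  using assms by (simp_all add: bicoeff_mult)

lemma bicoeff_mult_in_m: "(\<And>i j. bicoeff x i j \<in> m) \<Longrightarrow> bicoeff (g * x) i j \<in> m"
  unfolding bicoeff_mult by (intro ideal.subspace_sum[OF sub_m] ideal.subspace_scale[OF sub_m])

lemma in_J_iff:
  "x \<in> J \<longleftrightarrow> bicoeff x 0 0 = 0 \<and> bicoeff x 1 0 = 0 \<and> bicoeff x 0 1 = 0 \<and>
     (\<forall>i j. bicoeff x i j \<in> m) \<and> row_span (bicoeff x i1 j1) (bicoeff x i2 j2)"
proof -
  have "i + j < 2 \<longleftrightarrow> i = 0 \<and> j = 0 \<or> i = 1 \<and> j = 0 \<or> i = 0 \<and> j = 1" for i j :: nat
    by auto
  then have "(\<forall>i j. i + j < 2 \<longrightarrow> bicoeff x i j = 0) \<longleftrightarrow>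
      bicoeff x 0 0 = 0 \<and> bicoeff x 1 0 = 0 \<and> bicoeff x 0 1 = 0"
    by metis
  then show ?thesis
    by (simp add: J_def)
qed

lemma ideal_J: "ideal.subspace J"
proof (rule ideal_subspaceI)
  show "0 \<in> J"
    by (simp add: J_def ideal.subspace_0[OF sub_m] row_span_0)
  show "x + y \<in> J" if "x \<in> J" "y \<in> J" for x y
    using that by (auto simp: J_def intro: row_span_add ideal.subspace_add[OF sub_m])
  show "g * x \<in> J" if "x \<in> J" for g x
  proof -
    have *: "\<And>i j. i + j < 2 \<Longrightarrow> bicoeff x i j = 0"
      using that by (simp add: J_def)
    then have "row_span (bicoeff (g * x) i1 j1) (bicoeff (g * x) i2 j2)"
      using that exponents by (simp add: bicoeff_mult_degree_2 row_span_scale J_def)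
    moreover have "bicoeff (g * x) 0 0 = 0" "bicoeff (g * x) 1 0 = 0" "bicoeff (g * x) 0 1 = 0"
      using * by (simp_all add: bicoeff_mult_degree_1)
    ultimately show ?thesis
      using that bicoeff_mult_in_m by (simp add: in_J_iff)
  qed
qed

lemma det_in_m: "L1 * L2 \<in> m"
  using L_in_m ideal.subspace_scale[OF sub_m] by blast

text \<open>By Cramer's rule the determinant annihilates the cokernel of \<open>A\<close>, and it
  lies in \<open>m\<close>.\<close>

lemma det_mult_in_J:
  assumes "bicoeff x 0 0 = 0" "bicoeff x 1 0 = 0" "bicoeff x 0 1 = 0"
  shows "bimonom 0 0 (L1 * L2) * x \<in> J"
  using assms ideal_subspace_mult_right[OF sub_m det_in_m]
  by (simp add: in_J_iff bicoeff_bimonom_mult row_span_scale_iff)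

lemma associated_prime_origin: "associated_prime J {g. bicoeff g 0 0 = 0}"
proof -
  have "prime_ideal {g :: 'a poly poly. bicoeff g 0 0 = 0}"
    using prime_ideal_vimage[OF unital_hom_bicoeff_0 prime_ideal_zero] by (simp add: vimage_def)
  \<comment> \<open>The witness is \<open>s\<close> times the determinant. Having degree 1, it is
    killed by no nonzero constant, while multiplication by \<open>s\<close> or \<open>t\<close>
    raises it to degree 2, where the determinant forces it into \<open>J\<close>.\<close>
  moreover have "g * bimonom 1 0 (L1 * L2) \<in> J \<longleftrightarrow> bicoeff g 0 0 = 0" for g
  proof
    have "bicoeff (g * bimonom 1 0 (L1 * L2)) 1 0 = bicoeff g 0 0 * (L1 * L2)"
      by (simp add: bicoeff_mult bicoeff_bimonom)
    then show "bicoeff g 0 0 = 0" if "g * bimonom 1 0 (L1 * L2) \<in> J"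
      using that det_nonzero by (simp add: in_J_iff)
    have "g * bimonom 1 0 (L1 * L2) = bimonom 0 0 (L1 * L2) * (g * bimonom 1 0 1)"
      by (simp add: bimonom_mult mult.left_commute)
    then show "g * bimonom 1 0 (L1 * L2) \<in> J" if "bicoeff g 0 0 = 0"
      using that by (simp only: , intro det_mult_in_J) (simp_all add: bicoeff_mult bicoeff_bimonom)
  qed
  ultimately show ?thesis
    unfolding associated_prime_def by blast
qed

text \<open>The witness is \<open>Lb\<close> times the monomial of the first column. For a constant
  term \<open>c\<close> of \<open>g\<close>, Cramer's rule applied to the row
  \<open>(Lb * c, 0)\<close> asks, after cancelling \<open>Lb\<close>, that \<open>La\<close> divide
  \<open>c * l4\<close> and \<open>c * l2\<close>; since \<open>La\<close> is prime and misses one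
  of \<open>l2\<close>, \<open>l4\<close>, this means that it divides \<open>c\<close>.\<close>

lemma associated_prime_factor:
  assumes "La * Lb = L1 * L2" "prime_elem La" "\<not> (La dvd l2 \<and> La dvd l4)" "Lb \<in> m"
  shows "associated_prime J {g. La dvd bicoeff g 0 0}"
proof -
  have "prime_ideal {g :: 'a poly poly. La dvd bicoeff g 0 0}"
    using prime_ideal_vimage[OF unital_hom_bicoeff_0 prime_ideal_multiples[OF assms(2)]]
    by (simp add: vimage_def)
  moreover have "g * bimonom i1 j1 Lb \<in> J \<longleftrightarrow> La dvd bicoeff g 0 0" for g
  proof -
    have Lb: "Lb \<noteq> 0"
      using det_nonzero assms(1) by auto
    have x: "g * bimonom i1 j1 Lb = bimonom i1 j1 Lb * g"
      by (rule mult.commute)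
    have "g * bimonom i1 j1 Lb \<in> J \<longleftrightarrow> row_span (Lb * bicoeff g 0 0) 0"
      using exponents ideal_subspace_mult_right[OF sub_m assms(4)] ideal.subspace_0[OF sub_m]
      unfolding x in_J_iff by (auto simp: bicoeff_bimonom_mult)
    also have "\<dots> \<longleftrightarrow> Lb * La dvd Lb * (bicoeff g 0 0 * l4) \<and> Lb * La dvd Lb * (bicoeff g 0 0 * l2)"
      by (simp add: row_span_iff assms(1)[symmetric] mult.assoc mult.commute[of La])
    also have "\<dots> \<longleftrightarrow> La dvd bicoeff g 0 0 * l4 \<and> La dvd bicoeff g 0 0 * l2"
      using Lb by simp
    also have "\<dots> \<longleftrightarrow> La dvd bicoeff g 0 0"
      using assms(2,3) by (auto simp: prime_elem_dvd_mult_iff)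
    finally show ?thesis .
  qed
  ultimately show ?thesis
    unfolding associated_prime_def by blast
qed

text \<open>A colon ideal containing \<open>s\<close> and \<open>t\<close> is determined by its
  constants, because every \<open>g\<close> is congruent to its constant term modulo
  \<open>\<langle>s, t\<rangle>\<close>.\<close>

lemma colon_eqI:
  assumes P: "P = {g. g * x \<in> J}" and st: "bimonom 1 0 1 \<in> P" "bimonom 0 1 1 \<in> P"
    and c: "\<And>c. bimonom 0 0 c \<in> P \<longleftrightarrow> Q c"
  shows "P = {g. Q (bicoeff g 0 0)}"
proof -
  have sub: "ideal.subspace P"
    unfolding P using ideal_J
    by (intro ideal_subspaceI)
       (auto simp: distrib_right mult.assoc ideal.subspace_0 ideal.subspace_add ideal.subspace_scale)
  have "g - bimonom 0 0 (bicoeff g 0 0) \<in> P" for g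
  proof -
    \<comment> \<open>Divisibility by 0 means being 0, so this is the description of
      \<open>\<langle>s, t, L\<rangle>\<close> at \<open>L = 0\<close>.\<close>
    have "g - bimonom 0 0 (bicoeff g 0 0) \<in> {x. 0 dvd bicoeff x 0 0}"
      by (simp add: bicoeff_bimonom)
    then have "g - bimonom 0 0 (bicoeff g 0 0) \<in>
        ideal.span {bimonom 1 0 1, bimonom 0 1 1, bimonom 0 0 0}"
      by (simp only: ideal_span_bimonom)
    also have "\<dots> \<subseteq> P"
      using st sub by (intro ideal.span_minimal) (auto simp: ideal.subspace_0)
    finally show ?thesis .
  qed
  then have "g \<in> P \<longleftrightarrow> bimonom 0 0 (bicoeff g 0 0) \<in> P" for g
    using ideal.subspace_add[OF sub] ideal.subspace_diff[OF sub]
    by (metis diff_add_cancel add_diff_cancel_left' diff_eq_eq)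
  then show ?thesis
    using c by auto
qed

text \<open>Since \<open>(y, z)\<close> is outside the row span, one of its two Cramer expressions
  \<open>w\<close> is not divisible by \<open>La * Lb\<close>. As \<open>La\<close> kills the class,
  \<open>w = Lb * w'\<close> with \<open>w'\<close> not divisible by \<open>La\<close>; if
  \<open>c\<close> kills it too, then \<open>La\<close> divides \<open>c * w'\<close>, hence
  \<open>c\<close>.\<close>

lemma annihilator_factor:
  assumes q: "La * Lb = L1 * L2" and La: "prime_elem La"
    and ann: "row_span (La * y) (La * z)" and nz: "\<not> row_span y z"
  shows "row_span (c * y) (c * z) \<longleftrightarrow> La dvd c"
proof
  assume "La dvd c"
  then obtain d where "c = La * d" ..
  then show "row_span (c * y) (c * z)"
    using row_span_scale[OF ann, of d] by (simp add: mult_ac)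
next
  assume c: "row_span (c * y) (c * z)"
  have La0: "La \<noteq> 0" and Lb0: "Lb \<noteq> 0"
    using det_nonzero q by auto
  have "La dvd c" if "La * Lb dvd La * w" "La * Lb dvd c * w" "\<not> La * Lb dvd w" for w
  proof -
    have "Lb dvd w"
      using that(1) La0 by simp
    then obtain w' where w: "w = Lb * w'" ..
    with that(2) Lb0 have "La dvd c * w'"
      by (metis dvd_mult_cancel_right mult.assoc mult.commute)
    moreover have "\<not> La dvd w'"
      using that(3) Lb0 by (simp add: w mult.commute[of La])
    ultimately show ?thesis
      using La prime_elem_dvd_multD by blast
  qed
  then show "La dvd c"
    using ann c nz unfolding row_span_scale_iff row_span_iff[of y z] q by blast
qed

text \<open>No nonzero class of the cokernel is killed by both \<open>l2\<close> and
  \<open>l4\<close>, since neither \<open>L1\<close> nor \<open>L2\<close> divides both entries.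
  Splitting off \<open>L1\<close> first and then treating the quotient with \<open>L2\<close> also
  covers the case that the two factors are associated.\<close>

lemma row_span_cancel:
  assumes "row_span (l2 * y) (l2 * z)" "row_span (l4 * y) (l4 * z)"
  shows "row_span y z"
proof -
  have "L1 * L2 dvd w" if "L1 * L2 dvd l2 * w" "L1 * L2 dvd l4 * w" for w
  proof -
    have "L1 dvd w"
      using that not_dvd(1) prime_elem_dvd_multD[OF prime_L(1)] by (meson dvd_mult_left)
    then obtain w' where w: "w = L1 * w'" ..
    have "L1 \<noteq> 0" using prime_L by auto
    with that have "L2 dvd l2 * w'" "L2 dvd l4 * w'"
      by (simp_all add: w mult.left_commute[of _ L1])
    then have "L2 dvd w'"
      using not_dvd(2) prime_elem_dvd_multD[OF prime_L(2)] by blast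
    then show ?thesis
      by (simp add: w)
  qed
  then show ?thesis
    using assms unfolding row_span_scale_iff row_span_iff[of y z] by blast
qed

text \<open>The degree in which \<open>x\<close> starts decides: with a linear term, its annihilator
  has no nonzero constants; otherwise the constants of \<open>P\<close> annihilate a nonzero class
  of the cokernel of \<open>A\<close>.\<close>

lemma associated_prime_cases_origin:
  assumes P: "P = {g. g * x \<in> J}" and prime: "prime_ideal P"
    and st: "bimonom 1 0 1 \<in> P" "bimonom 0 1 1 \<in> P"
  shows "P = {g. bicoeff g 0 0 = 0} \<or> P = {g. L1 dvd bicoeff g 0 0} \<or> P = {g. L2 dvd bicoeff g 0 0}"
proof -
  have sx: "bimonom 1 0 1 * x \<in> J" and tx: "bimonom 0 1 1 * x \<in> J"
    using st by (simp_all add: P)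
  \<comment> \<open>The coefficients of \<open>s x\<close> and \<open>t x\<close>, which lie in
    \<open>J\<close>, are those of \<open>x\<close> shifted by one degree. Hence \<open>x\<close>
    has no constant term and all its coefficients are in \<open>m\<close>.\<close>
  have shift: "bicoeff (bimonom 1 0 1 * x) (Suc i) j = bicoeff x i j"
    "bicoeff (bimonom 0 1 1 * x) i (Suc j) = bicoeff x i j" for i j
    by (simp_all add: bicoeff_bimonom_mult)
  have x0: "bicoeff x 0 0 = 0"
    using sx shift(1)[of 0 0] by (simp add: in_J_iff)
  have xm: "bicoeff x i j \<in> m" for i j
    using sx shift(1)[of i j] by (metis in_J_iff)
  show ?thesis
  proof (cases "bicoeff x 1 0 = 0 \<and> bicoeff x 0 1 = 0")
    case False
    have c: "bimonom 0 0 c \<in> P \<longleftrightarrow> c = 0" for c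
    proof
      assume "bimonom 0 0 c \<in> P"
      then have "bimonom 0 0 c * x \<in> J"
        by (simp add: P)
      then have "bicoeff (bimonom 0 0 c * x) 1 0 = 0" "bicoeff (bimonom 0 0 c * x) 0 1 = 0"
        by (simp_all only: in_J_iff)
      then show "c = 0"
        using False by (auto simp: bicoeff_bimonom_mult)
    next
      show "bimonom 0 0 c \<in> P" if "c = 0"
        using that ideal.subspace_0[OF ideal_J] by (simp add: P)
    qed
    then show ?thesis
      using colon_eqI[OF P st, of "\<lambda>c. c = 0"] by simp
  next
    case True
    let ?y = "bicoeff x i1 j1" and ?z = "bicoeff x i2 j2"
    have c: "bimonom 0 0 c \<in> P \<longleftrightarrow> row_span (c * ?y) (c * ?z)" for c
      using True x0 xm ideal.subspace_scale[OF sub_m]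
      by (simp add: P in_J_iff bicoeff_bimonom_mult)
    have nz: "\<not> row_span ?y ?z"
    proof -
      have "1 \<notin> P"
        using prime by (rule prime_idealD)
      moreover have "(1 :: 'a poly poly) = bimonom 0 0 1"
        by (simp add: bimonom_def)
      ultimately show ?thesis
        using c[of 1] by simp
    qed
    \<comment> \<open>The determinant annihilates the cokernel, so primality of \<open>P\<close>
      puts one of its two factors into \<open>P\<close>.\<close>
    have "bimonom 0 0 (L1 * L2) \<in> P"
      by (simp add: c row_span_iff mult.assoc flip: right_diff_distrib)
    then have "bimonom 0 0 L1 * bimonom 0 0 L2 \<in> P"
      by (simp add: bimonom_mult)
    then consider "bimonom 0 0 L1 \<in> P" | "bimonom 0 0 L2 \<in> P"
      using prime_idealD(3)[OF prime] by blast
    then show ?thesis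
    proof cases
      case 1
      then show ?thesis
        using colon_eqI[OF P st, of "\<lambda>c. L1 dvd c"] annihilator_factor[of L1 L2 ?y ?z] prime_L nz c
        by auto
    next
      case 2
      then show ?thesis
        using colon_eqI[OF P st, of "\<lambda>c. L2 dvd c"] annihilator_factor[of L2 L1 ?y ?z] prime_L nz c
        by (auto simp: mult.commute)
    qed
  qed
qed

text \<open>Both \<open>l2\<close> and \<open>l4\<close> kill \<open>x\<close> modulo
  \<open>J\<close>. Cancelling them shows that \<open>x\<close> passes every test for
  \<open>J\<close> except the one on \<open>m\<close>; as \<open>x\<close> is not in
  \<open>J\<close>, some coefficient escapes \<open>m\<close>. Now \<open>g * x\<close> in
  \<open>J\<close> has all coefficients in \<open>m\<close>, and primality of the extension of
  \<open>m\<close> moves this condition to \<open>g\<close>.\<close>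

lemma associated_prime_cases_m:
  assumes P: "P = {g. g * x \<in> J}" and prime: "prime_ideal P"
    and m: "\<And>c. c \<in> m \<Longrightarrow> bimonom 0 0 c \<in> P"
  shows "P = {g. \<forall>i j. bicoeff g i j \<in> m}"
proof -
  let ?mR = "{g. \<forall>i j. bicoeff g i j \<in> m}"
  have lx: "bimonom 0 0 l2 * x \<in> J" "bimonom 0 0 l4 * x \<in> J"
    using m l_in_m by (auto simp: P)
  have l_nz: "l2 \<noteq> 0 \<or> l4 \<noteq> 0"
    using not_dvd by auto
  have l: "l * bicoeff x 0 0 = 0 \<and> l * bicoeff x 1 0 = 0 \<and> l * bicoeff x 0 1 = 0 \<and>
      row_span (l * bicoeff x i1 j1) (l * bicoeff x i2 j2)"
    if "bimonom 0 0 l * x \<in> J" for l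
    using that by (simp add: in_J_iff bicoeff_bimonom_mult)
  have x0: "bicoeff x 0 0 = 0" "bicoeff x 1 0 = 0" "bicoeff x 0 1 = 0"
  proof -
    have "bicoeff x 0 0 = 0 \<and> bicoeff x 1 0 = 0 \<and> bicoeff x 0 1 = 0"
      if "bimonom 0 0 l * x \<in> J" "l \<noteq> 0" for l
      using l[OF that(1)] that(2) by simp
    then show "bicoeff x 0 0 = 0" "bicoeff x 1 0 = 0" "bicoeff x 0 1 = 0"
      using lx l_nz by blast+
  qed
  have "row_span (bicoeff x i1 j1) (bicoeff x i2 j2)"
    using lx[THEN l] by (blast intro: row_span_cancel[of "bicoeff x i1 j1"])
  moreover have "x \<notin> J"
    using prime_idealD(2)[OF prime] by (simp add: P)
  ultimately have x: "x \<notin> ?mR"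
    using x0 by (simp add: in_J_iff)
  have "prime_ideal ?mR"
    using prime_ideal_coeffs[OF prime_ideal_coeffs[OF prime_m]] by simp
  then have "P \<subseteq> ?mR"
    using x prime_idealD(3) by (fastforce simp: P J_def)
  moreover have "g \<in> P" if g: "g \<in> ?mR" for g
  proof -
    have "bimonom i j (bicoeff g i j) \<in> P" for i j
    proof -
      have "bimonom i j (bicoeff g i j) = bimonom i j 1 * bimonom 0 0 (bicoeff g i j)"
        by (simp add: bimonom_mult)
      then show ?thesis
        using m g ideal.subspace_scale[OF prime_idealD(1)[OF prime]] by simp
    qed
    then have "(\<Sum>i\<le>degree g. \<Sum>j\<le>degree (coeff g i). bimonom i j (bicoeff g i j)) \<in> P"
      by (intro ideal.subspace_sum[OF prime_idealD(1)[OF prime]])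
    then show ?thesis
      by (simp only: bipoly_as_sum_of_bimonoms)
  qed
  ultimately show ?thesis by blast
qed

lemma associated_prime_cases:
  assumes "associated_prime J P"
  shows "P = {g. bicoeff g 0 0 = 0} \<or> P = {g. L1 dvd bicoeff g 0 0} \<or>
    P = {g. L2 dvd bicoeff g 0 0} \<or> P = {g. \<forall>i j. bicoeff g i j \<in> m}"
proof -
  from assms obtain x where prime: "prime_ideal P" and P: "P = {g. g * x \<in> J}"
    by (auto simp: associated_prime_def)
  have sub: "J \<subseteq> P"
    using ideal_subspace_mult_right[OF ideal_J] by (auto simp: P)
  have power_mult: "y \<in> P \<or> z \<in> P" if "y * y * y * z \<in> P" for y z
    using that prime_idealD(3)[OF prime] by blast
  show ?thesis
  proof (cases "bimonom 1 0 1 \<in> P \<and> bimonom 0 1 1 \<in> P")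
    case True
    then show ?thesis
      using associated_prime_cases_origin[OF P prime] by blast
  next
    case False
    have "bimonom 0 0 c \<in> P" if "c \<in> m" for c
    proof -
      \<comment> \<open>In degree 3 the row condition is vacuous: both quadratic coefficients are
        0.\<close>
      have 3: "bimonom i j c \<in> P" if "i + j = 3" for i j
        using that \<open>c \<in> m\<close> exponents ideal.subspace_0[OF sub_m] sub
        by (intro subsetD[OF sub]) (auto simp: in_J_iff bicoeff_bimonom row_span_0)
      have "bimonom 1 0 1 * bimonom 1 0 1 * bimonom 1 0 1 * bimonom 0 0 c \<in> P"
        "bimonom 0 1 1 * bimonom 0 1 1 * bimonom 0 1 1 * bimonom 0 0 c \<in> P"
        using 3[of 3 0] 3[of 0 3] by (simp_all add: bimonom_mult numeral_3_eq_3)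
      then show ?thesis
        using False power_mult by blast
    qed
    then show ?thesis
      using associated_prime_cases_m[OF P prime] by blast
  qed
qed

text \<open>Of the candidates, all but the extension of \<open>m\<close> contain \<open>s\<close>,
  and that one does not; so nothing in the list lies strictly below it. It contains
  \<open>L1\<close>, which \<open>\<langle>s, t\<rangle>\<close> does not, so
  \<open>\<langle>s, t\<rangle>\<close> is minimal as well. The remaining two are strictly larger
  than \<open>\<langle>s, t\<rangle>\<close>.\<close>

theorem embedded_primes:
  "{P. embedded_prime J P} = {{g. L1 dvd bicoeff g 0 0}, {g. L2 dvd bicoeff g 0 0}}"
proof -
  let ?O = "{g :: 'a poly poly. bicoeff g 0 0 = 0}"
  let ?mR = "{g. \<forall>i j. bicoeff g i j \<in> m}"
  have m1: "1 \<notin> m"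
    using prime_m by (rule prime_idealD)
  have L0: "L1 \<noteq> 0" "L2 \<noteq> 0"
    using prime_L by auto
  have O_sub: "?O \<subset> {g. L dvd bicoeff g 0 0}" if "L \<noteq> 0" for L
  proof -
    have "bimonom 0 0 L \<in> {g. L dvd bicoeff g 0 0} - ?O"
      using that by (simp add: bicoeff_bimonom)
    then show ?thesis by auto
  qed
  have mR_min: "\<not> Q \<subset> ?mR" if "associated_prime J Q" for Q
  proof
    assume "Q \<subset> ?mR"
    moreover have "bimonom 1 0 1 \<notin> ?mR"
      using m1 by (auto simp: bicoeff_bimonom)
    moreover have "bimonom 1 0 1 \<in> ?O" "bimonom 1 0 1 \<in> {g. L1 dvd bicoeff g 0 0}"
      "bimonom 1 0 1 \<in> {g. L2 dvd bicoeff g 0 0}"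
      by (simp_all add: bicoeff_bimonom)
    ultimately show False
      using associated_prime_cases[OF that] by blast
  qed
  have O_min: "\<not> Q \<subset> ?O" if "associated_prime J Q" for Q
  proof
    assume Q: "Q \<subset> ?O"
    have "bimonom 0 0 L1 \<in> ?mR" "bimonom 0 0 L1 \<notin> ?O"
      using L0 L_in_m ideal.subspace_0[OF sub_m] by (auto simp: bicoeff_bimonom)
    then have "Q \<noteq> ?mR" using Q by blast
    moreover have "\<not> {g. L1 dvd bicoeff g 0 0} \<subset> ?O" "\<not> {g. L2 dvd bicoeff g 0 0} \<subset> ?O"
      using O_sub[OF L0(1)] O_sub[OF L0(2)] by blast+
    ultimately show False
      using associated_prime_cases[OF that] Q by blast
  qed
  have "associated_prime J {g. L1 dvd bicoeff g 0 0}"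
    using prime_L not_dvd L_in_m by (intro associated_prime_factor[of L1 L2]) auto
  moreover have "associated_prime J {g. L2 dvd bicoeff g 0 0}"
    using prime_L not_dvd L_in_m by (intro associated_prime_factor[of L2 L1]) (auto simp: mult.commute)
  ultimately have emb: "embedded_prime J {g. L1 dvd bicoeff g 0 0}"
      "embedded_prime J {g. L2 dvd bicoeff g 0 0}"
    unfolding embedded_prime_def
    using O_sub[OF L0(1)] O_sub[OF L0(2)] associated_prime_origin by blast+
  have "P \<in> {{g. L1 dvd bicoeff g 0 0}, {g. L2 dvd bicoeff g 0 0}}" if P: "embedded_prime J P" for P
  proof -
    from P obtain Q where Q: "associated_prime J Q" "Q \<subset> P" and ass: "associated_prime J P"
      by (auto simp: embedded_prime_def)
    have "P \<noteq> ?O" "P \<noteq> ?mR"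
      using O_min[OF Q(1)] mR_min[OF Q(1)] Q(2) by metis+
    then show ?thesis
      using associated_prime_cases[OF ass] by simp
  qed
  with emb show ?thesis
    by blast
qed

end


section \<open>The explicit ideal is generated by a normal form\<close>

text \<open>The coefficients that a fixed monomial admits in \<open>I\<close> form an ideal of the
  coefficient ring, so two generators suffice. This passes from two linear forms to all of
  \<open>m\<close>; \<open>i'\<close> and \<open>j'\<close> allow a monomial factor in
  between.\<close>

lemma bimonom_coefficients_ideal:
  assumes "ideal.subspace I" and "i' + i = a" "j' + j = b" and "bimonom i j l \<in> I" "bimonom i j l' \<in> I"
    and "c \<in> ideal.span {l, l'}"
  shows "bimonom a b c \<in> I"
proof -
  have "ideal.subspace {c. bimonom a b c \<in> I}"
  proof (rule ideal_subspaceI)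
    show "d * c \<in> {c. bimonom a b c \<in> I}" if "c \<in> {c. bimonom a b c \<in> I}" for c d
      using that ideal.subspace_scale[OF assms(1), of "bimonom a b c" "bimonom 0 0 d"]
      by (simp add: bimonom_mult)
  qed (auto simp: ideal.subspace_0[OF assms(1)] ideal.subspace_add[OF assms(1)]
      simp flip: bimonom_add)
  moreover have "{l, l'} \<subseteq> {c. bimonom a b c \<in> I}"
    using ideal.subspace_scale[OF assms(1) assms(4), of "bimonom i' j' 1"]
      ideal.subspace_scale[OF assms(1) assms(5), of "bimonom i' j' 1"] assms(2,3)
    by (simp add: bimonom_mult)
  ultimately have "ideal.span {l, l'} \<subseteq> {c. bimonom a b c \<in> I}"
    by (rule ideal.span_minimal[rotated])
  with assms(6) show ?thesis by blast
qed

context form_ideal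
begin

text \<open>Here \<open>(ih, jh)\<close> is the exponent of \<open>h\<close>, the monomial
  multiplying \<open>u\<close> and \<open>v\<close>. The quadratic part \<open>z\<close> of an
  element of \<open>J\<close> is rebuilt from the generators; the rest has only terms of degree at
  least 3 with coefficients in \<open>m\<close>, each a multiple of a cubic one.\<close>

lemma J_eqI:
  assumes I: "ideal.subspace I" "I \<subseteq> J"
    and all: "\<And>i j. i + j = 2 \<Longrightarrow> (i, j) = (ih, jh) \<or> (i, j) = (i1, j1) \<or> (i, j) = (i2, j2)"
    and distinct: "(ih, jh) \<noteq> (i1, j1)" "(ih, jh) \<noteq> (i2, j2)"
    and gens: "bimonom i1 j1 l1 + bimonom i2 j2 l2 \<in> I" "bimonom i1 j1 l3 + bimonom i2 j2 l4 \<in> I"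
    and hm: "\<And>c. c \<in> m \<Longrightarrow> bimonom ih jh c \<in> I"
    and cubic: "\<And>i j c. i + j = 3 \<Longrightarrow> c \<in> m \<Longrightarrow> bimonom i j c \<in> I"
  shows "I = J"
proof
  show "J \<subseteq> I"
  proof
    fix x assume x: "x \<in> J"
    then obtain a b where ab: "bicoeff x i1 j1 = a * l1 + b * l3" "bicoeff x i2 j2 = a * l2 + b * l4"
      by (auto simp: J_def row_span_def)
    define z where "z = bimonom ih jh (bicoeff x ih jh) + (bimonom i1 j1 (bicoeff x i1 j1) +
      bimonom i2 j2 (bicoeff x i2 j2))"
    have "bimonom i1 j1 (bicoeff x i1 j1) + bimonom i2 j2 (bicoeff x i2 j2) =
        bimonom 0 0 a * (bimonom i1 j1 l1 + bimonom i2 j2 l2) +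
        bimonom 0 0 b * (bimonom i1 j1 l3 + bimonom i2 j2 l4)"
      by (simp add: ab distrib_left bimonom_mult flip: bimonom_add)
    also have "\<dots> \<in> I"
      by (intro ideal.subspace_add[OF I(1)] ideal.subspace_scale[OF I(1)] gens)
    finally have z: "z \<in> I"
      unfolding z_def using x by (intro ideal.subspace_add[OF I(1) hm]) (auto simp: J_def)
    have "bimonom i j (bicoeff (x - z) i j) \<in> I" for i j
    proof -
      consider "i + j < 2" | "i + j = 2" | "i + j \<ge> 3" by linarith
      then show ?thesis
      proof cases
        case 1
        then have "bicoeff (x - z) i j = 0"
          using x subsetD[OF I(2) z] by (simp add: J_def)
        then show ?thesis
          by (simp add: ideal.subspace_0[OF I(1)])
      next
        case 2
        then have "bicoeff (x - z) i j = 0"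
          using all[OF 2] distinct exponents(3) by (auto simp: z_def bicoeff_bimonom)
        then show ?thesis
          by (simp add: ideal.subspace_0[OF I(1)])
      next
        case 3
        \<comment> \<open>Taking as many factors \<open>s\<close> as possible, up to three, and
          filling up with \<open>t\<close> splits a cubic divisor off
          \<open>s^i t^j\<close>.\<close>
        define i' where "i' = min i 3"
        have i': "i' \<le> i" "i' \<le> 3" "3 - i' \<le> j"
          using 3 by (auto simp: i'_def)
        have "bicoeff (x - z) i j \<in> m"
          using x subsetD[OF I(2) z] by (simp add: J_def ideal.subspace_diff[OF sub_m])
        then have "bimonom i' (3 - i') (bicoeff (x - z) i j) \<in> I"
          using i' by (intro cubic) auto
        then have "bimonom (i - i') (j - (3 - i')) 1 * bimonom i' (3 - i') (bicoeff (x - z) i j) \<in> I"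
          by (rule ideal.subspace_scale[OF I(1)])
        then show ?thesis
          using i' by (simp add: bimonom_mult)
      qed
    qed
    then have "(\<Sum>i\<le>degree (x - z). \<Sum>j\<le>degree (coeff (x - z) i).
        bimonom i j (bicoeff (x - z) i j)) \<in> I"
      by (intro ideal.subspace_sum[OF I(1)])
    then have "x - z \<in> I"
      by (simp only: bipoly_as_sum_of_bimonoms)
    then show "x \<in> I"
      using ideal.subspace_add[OF I(1) _ z] by (metis diff_add_cancel)
  qed
qed (rule I(2))

lemma gens_in_J:
  "bimonom i1 j1 l1 + bimonom i2 j2 l2 \<in> J" "bimonom i1 j1 l3 + bimonom i2 j2 l4 \<in> J"
proof -
  have "bimonom i1 j1 y + bimonom i2 j2 z \<in> J" if "y \<in> m" "z \<in> m" "row_span y z" for y z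
    using that exponents ideal.subspace_0[OF sub_m] ideal.subspace_add[OF sub_m]
    by (auto simp: J_def bicoeff_bimonom)
  moreover have "row_span l1 l2" "row_span l3 l4"
    unfolding row_span_def
    by (rule exI[of _ 1], rule exI[of _ 0], simp) (rule exI[of _ 0], rule exI[of _ 1], simp)
  ultimately show "bimonom i1 j1 l1 + bimonom i2 j2 l2 \<in> J" "bimonom i1 j1 l3 + bimonom i2 j2 l4 \<in> J"
    using l_in_m by blast+
qed

lemma bimonom_in_J:
  assumes "i0 + j0 = 2" "(i0, j0) \<noteq> (i1, j1)" "(i0, j0) \<noteq> (i2, j2)" "c \<in> m"
  shows "bimonom i0 j0 c \<in> J"
  using assms ideal.subspace_0[OF sub_m] row_span_0 by (auto simp: J_def bicoeff_bimonom)

end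

text \<open>With \<open>h = s^2\<close> the cubic terms are reached in a chain: \<open>s^2 m\<close>
  is given; \<open>s\<close> times the mixed generators, modulo \<open>s^2 t m\<close>, yields
  \<open>s t^2 l2\<close> and \<open>s t^2 l4\<close>, hence \<open>s t^2 m\<close>; then
  \<open>t\<close> times the same generators yields \<open>t^3 m\<close>.\<close>

lemma (in form_ideal) span_eq_J_square:
  assumes e: "i1 = 1" "j1 = 1" "i2 = 0" "j2 = 2"
    and m: "m = ideal.span {u, v}" "m = ideal.span {l2, l4}"
  shows "ideal.span {bimonom 2 0 u, bimonom 2 0 v,
    bimonom 1 1 l1 + bimonom 0 2 l2, bimonom 1 1 l3 + bimonom 0 2 l4} = J" (is "?I = J")
proof (rule J_eqI[where ih = 2 and jh = 0])
  show I: "ideal.subspace ?I" by simp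
  have uv: "u \<in> m" "v \<in> m"
    unfolding m(1) by (auto intro: ideal.span_base)
  show "?I \<subseteq> J"
    using gens_in_J bimonom_in_J[of 2 0] uv
    by (intro ideal.span_minimal ideal_J) (simp add: e)
  show gens: "bimonom i1 j1 l1 + bimonom i2 j2 l2 \<in> ?I" "bimonom i1 j1 l3 + bimonom i2 j2 l4 \<in> ?I"
    by (auto simp: e intro: ideal.span_base)
  show "(i, j) = (2, 0) \<or> (i, j) = (i1, j1) \<or> (i, j) = (i2, j2)" if "i + j = 2" for i j
    using that by (auto simp: e)
  have u: "bimonom 2 0 u \<in> ?I" "bimonom 2 0 v \<in> ?I"
    by (auto intro: ideal.span_base)
  have s2: "bimonom (2 + i) j c \<in> ?I" if "c \<in> m" for i j c
    using that unfolding m(1) by (intro bimonom_coefficients_ideal[OF I _ _ u, of i _ j]) auto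
  show "bimonom 2 0 c \<in> ?I" if "c \<in> m" for c
    using s2[OF that, of 0 0] by simp
  have st2: "bimonom 1 2 l2 \<in> ?I" "bimonom 1 2 l4 \<in> ?I"
  proof -
    have *: "bimonom 1 2 z \<in> ?I" if "bimonom i1 j1 y + bimonom i2 j2 z \<in> ?I" "y \<in> m" for y z
    proof -
      have "bimonom 1 2 z = bimonom 1 0 1 * (bimonom i1 j1 y + bimonom i2 j2 z) - bimonom (2 + 0) 1 y"
        by (simp add: e distrib_left bimonom_mult numeral_2_eq_2)
      also have "\<dots> \<in> ?I"
        by (intro ideal.span_diff ideal.span_scale s2 that)
      finally show ?thesis .
    qed
    show "bimonom 1 2 l2 \<in> ?I" "bimonom 1 2 l4 \<in> ?I"
      using *[OF gens(1)] *[OF gens(2)] l_in_m by auto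
  qed
  have st2m: "bimonom 1 2 c \<in> ?I" if "c \<in> m" for c
    using that unfolding m(2) by (intro bimonom_coefficients_ideal[OF I _ _ st2, of 0 _ 0]) auto
  have t3: "bimonom 0 3 l2 \<in> ?I" "bimonom 0 3 l4 \<in> ?I"
  proof -
    have *: "bimonom 0 3 z \<in> ?I" if "bimonom i1 j1 y + bimonom i2 j2 z \<in> ?I" "y \<in> m" for y z
    proof -
      have "bimonom 0 3 z = bimonom 0 1 1 * (bimonom i1 j1 y + bimonom i2 j2 z) - bimonom 1 2 y"
        by (simp add: e distrib_left bimonom_mult numeral_2_eq_2 numeral_3_eq_3)
      also have "\<dots> \<in> ?I"
        by (intro ideal.span_diff ideal.span_scale st2m that)
      finally show ?thesis .
    qed
    show "bimonom 0 3 l2 \<in> ?I" "bimonom 0 3 l4 \<in> ?I"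
      using *[OF gens(1)] *[OF gens(2)] l_in_m by auto
  qed
  have t3m: "bimonom 0 3 c \<in> ?I" if "c \<in> m" for c
    using that unfolding m(2) by (intro bimonom_coefficients_ideal[OF I _ _ t3, of 0 _ 0]) auto
  show "bimonom i j c \<in> ?I" if "i + j = 3" "c \<in> m" for i j c
  proof -
    have "i = 0 \<and> j = 3 \<or> i = 1 \<and> j = 2 \<or> i = 2 + (i - 2)"
      using that(1) by arith
    then consider "i = 0" "j = 3" | "i = 1" "j = 2" | "i = 2 + (i - 2)"
      by blast
    then show ?thesis
      using s2[OF that(2), of "i - 2" j] st2m[OF that(2)] t3m[OF that(2)] by cases simp_all
  qed
qed (simp_all add: e)

text \<open>With \<open>h = s t\<close> the mixed cubics are given. Multiplying the other generators
  by \<open>s\<close> isolates \<open>s^3 l1\<close> and \<open>s^3 l3\<close>, and multiplying by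
  \<open>t\<close> isolates \<open>t^3 l2\<close> and \<open>t^3 l4\<close>; this is why both
  columns have to generate \<open>m\<close>.\<close>

lemma (in form_ideal) span_eq_J_split:
  assumes e: "i1 = 2" "j1 = 0" "i2 = 0" "j2 = 2"
    and m: "m = ideal.span {u, v}" "m = ideal.span {l1, l3}" "m = ideal.span {l2, l4}"
  shows "ideal.span {bimonom 1 1 u, bimonom 1 1 v,
    bimonom 2 0 l1 + bimonom 0 2 l2, bimonom 2 0 l3 + bimonom 0 2 l4} = J" (is "?I = J")
proof (rule J_eqI[where ih = 1 and jh = 1])
  show I: "ideal.subspace ?I" by simp
  have uv: "u \<in> m" "v \<in> m"
    unfolding m(1) by (auto intro: ideal.span_base)
  show "?I \<subseteq> J"
    using gens_in_J bimonom_in_J[of 1 1] uv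
    by (intro ideal.span_minimal ideal_J) (simp add: e)
  show gens: "bimonom i1 j1 l1 + bimonom i2 j2 l2 \<in> ?I" "bimonom i1 j1 l3 + bimonom i2 j2 l4 \<in> ?I"
    by (auto simp: e intro: ideal.span_base)
  show "(i, j) = (1, 1) \<or> (i, j) = (i1, j1) \<or> (i, j) = (i2, j2)" if "i + j = 2" for i j
    using that by (auto simp: e)
  have u: "bimonom 1 1 u \<in> ?I" "bimonom 1 1 v \<in> ?I"
    by (auto intro: ideal.span_base)
  have st: "bimonom (1 + i) (1 + j) c \<in> ?I" if "c \<in> m" for i j c
    using that unfolding m(1) by (intro bimonom_coefficients_ideal[OF I _ _ u, of i _ j]) auto
  show "bimonom 1 1 c \<in> ?I" if "c \<in> m" for c
    using st[OF that, of 0 0] by simp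
  have *: "bimonom 3 0 y \<in> ?I \<and> bimonom 0 3 z \<in> ?I"
    if "bimonom i1 j1 y + bimonom i2 j2 z \<in> ?I" "y \<in> m" "z \<in> m" for y z
  proof -
    have "bimonom 3 0 y = bimonom 1 0 1 * (bimonom i1 j1 y + bimonom i2 j2 z) - bimonom (1 + 0) (1 + 1) z"
      by (simp add: e distrib_left bimonom_mult numeral_2_eq_2 numeral_3_eq_3)
    also have "\<dots> \<in> ?I"
      by (intro ideal.span_diff ideal.span_scale st that)
    finally have y: "bimonom 3 0 y \<in> ?I" .
    have "bimonom 0 3 z = bimonom 0 1 1 * (bimonom i1 j1 y + bimonom i2 j2 z) - bimonom (1 + 1) (1 + 0) y"
      by (simp add: e distrib_left bimonom_mult numeral_2_eq_2 numeral_3_eq_3)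
    also have "\<dots> \<in> ?I"
      by (intro ideal.span_diff ideal.span_scale st that)
    finally show ?thesis
      using y by simp
  qed
  have s3: "bimonom 3 0 l1 \<in> ?I" "bimonom 3 0 l3 \<in> ?I"
    and t3: "bimonom 0 3 l2 \<in> ?I" "bimonom 0 3 l4 \<in> ?I"
    using *[OF gens(1)] *[OF gens(2)] l_in_m by auto
  have s3m: "bimonom 3 0 c \<in> ?I" if "c \<in> m" for c
    using that unfolding m(2) by (intro bimonom_coefficients_ideal[OF I _ _ s3, of 0 _ 0]) auto
  have t3m: "bimonom 0 3 c \<in> ?I" if "c \<in> m" for c
    using that unfolding m(3) by (intro bimonom_coefficients_ideal[OF I _ _ t3, of 0 _ 0]) auto
  show "bimonom i j c \<in> ?I" if "i + j = 3" "c \<in> m" for i j c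
  proof -
    have "i = 0 \<and> j = 3 \<or> i = 3 \<and> j = 0 \<or> i = 1 + (i - 1) \<and> j = 1 + (j - 1)"
      using that(1) by arith
    then consider "i = 0" "j = 3" | "i = 3" "j = 0" | "i = 1 + (i - 1)" "j = 1 + (j - 1)"
      by blast
    then show ?thesis
      using st[OF that(2), of "i - 1" "j - 1"] s3m[OF that(2)] t3m[OF that(2)] by cases simp_all
  qed
qed (simp_all add: e)


section \<open>Linear forms in two variables\<close>

definition linform :: "'k::field \<Rightarrow> 'k \<Rightarrow> 'k poly poly" where
  "linform a b = bimonom 1 0 a + bimonom 0 1 b"

lemma linform_eq_pCons: "linform a b = [:[:0, b:], [:a:]:]"
  by (simp add: linform_def bimonom_def monom_Suc monom_0 )

lemma bicoeff_linform:
  "bicoeff (linform a b) i j = (if i = 1 \<and> j = 0 then a else if i = 0 \<and> j = 1 then b else 0)"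
  by (simp add: linform_def bicoeff_bimonom)

lemma linform_eq_iff: "linform a b = linform c d \<longleftrightarrow> a = c \<and> b = d"
  by (auto simp: linform_eq_pCons)

lemma linform_eq_0_iff: "linform a b = 0 \<longleftrightarrow> a = 0 \<and> b = 0"
  by (auto simp: linform_eq_pCons)

lemma linform_scale: "[:[:c:]:] * linform a b = linform (c * a) (c * b)"
  by (simp add: linform_eq_pCons)

lemma linform_add: "linform a b + linform c d = linform (a + c) (b + d)"
  by (simp add: linform_eq_pCons)

text \<open>Up to a unit the polynomial is \<open>X - r\<close>, whose multiples are the polynomials
  vanishing at \<open>r\<close>; over a domain this condition is prime.\<close>

lemma prime_elem_linear_unit:
  fixes a b :: "'a::idom"
  assumes "b dvd 1"
  shows "prime_elem [:a, b:]"
proof -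
  from assms obtain b' where b': "1 = b * b'" ..
  define r where "r = - (a * b')"
  have ab: "[:a, b:] = [:b:] * [:- r, 1:]"
    using b' by (simp add: r_def algebra_simps)
  have "[:- r, 1:] = [:b':] * [:a, b:]"
    using b' by (simp add: r_def mult.commute)
  with ab have "[:a, b:] dvd [:- r, 1:]" "[:- r, 1:] dvd [:a, b:]"
    by (metis dvd_triv_right)+
  then have dvd: "[:a, b:] dvd p \<longleftrightarrow> poly p r = 0" for p
    unfolding poly_eq_0_iff_dvd using dvd_trans by blast
  show ?thesis
  proof (rule prime_elemI)
    show "[:a, b:] \<noteq> 0"
      using assms by auto
  qed (auto simp: dvd)
qed

lemma prime_elem_linform:
  assumes "(a, b) \<noteq> (0, 0)"
  shows "prime_elem (linform a b)"
proof (cases "a = 0")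
  case False
  then have "[:a:] dvd 1" by (simp add: is_unit_const_poly_iff dvd_field_iff)
  then show ?thesis
    unfolding linform_eq_pCons by (rule prime_elem_linear_unit)
next
  case True
  then have "b dvd 1" using assms by (simp add: dvd_field_iff)
  then have "prime_elem [:0, b:]" by (rule prime_elem_linear_unit)
  then show ?thesis
    using True by (simp add: linform_eq_pCons prime_elem_const_poly_iff)
qed

lemma linform_dvd_linform:
  assumes "linform a b dvd linform c d"
  shows "a * d = b * c"
proof -
  from assms obtain g where "linform c d = linform a b * g" ..
  \<comment> \<open>Evaluation at \<open>u = b\<close>, \<open>v = - a\<close>, a zero of the
    divisor.\<close>
  then have "poly (poly (linform c d) [:b:]) (- a) = poly (poly (linform a b) [:b:]) (- a) * poly (poly g [:b:]) (- a)"
    by simp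
  then show ?thesis
    by (simp add: linform_eq_pCons algebra_simps)
qed

text \<open>The inverse of the coefficient matrix expresses \<open>u\<close> and \<open>v\<close> by
  the two forms, so both pairs generate the ideal of polynomials without constant term.\<close>

lemma span_linforms:
  assumes "a * d - b * c \<noteq> 0"
  shows "ideal.span {linform a b, linform c d} = {x. bicoeff x 0 0 = 0}" (is "?I = ?M")
proof -
  have "ideal.span {linform 1 0, linform 0 1} = {x :: 'a poly poly. bicoeff x 0 0 = 0}"
  proof -
    have "ideal.span {linform 1 0, linform 0 1} = ideal.span {linform 1 0, linform 0 (1 :: 'a), bimonom 0 0 0}"
      unfolding ideal.span_eq by (auto intro: ideal.span_base ideal.span_zero)
    then show ?thesis
      using ideal_span_bimonom[of "0 :: 'a"] by (simp add: linform_def)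
  qed
  moreover have "?I = ideal.span {linform 1 0, linform 0 1}"
  proof
    have lin: "linform x y = [:[:x:]:] * linform 1 0 + [:[:y:]:] * linform 0 1" for x y :: 'a
      unfolding linform_scale linform_add by simp
    have "linform x y \<in> ideal.span {linform 1 0, linform 0 1}" for x y :: 'a
      unfolding lin[of x y] by (intro ideal.span_add ideal.span_scale ideal.span_base) auto
    then show "?I \<subseteq> ideal.span {linform 1 0, linform 0 1}"
      by (intro ideal.span_minimal) auto
    define D where "D = a * d - b * c"
    have "linform 1 0 = [:[:d / D:]:] * linform a b + [:[:- b / D:]:] * linform c d"
      "linform 0 1 = [:[:- c / D:]:] * linform a b + [:[:a / D:]:] * linform c d"
      unfolding linform_scale linform_add linform_eq_iff
      using assms by (simp_all add: D_def divide_simps)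
    moreover have "[:[:x:]:] * linform a b + [:[:y:]:] * linform c d \<in> ?I" for x y
      by (intro ideal.span_add ideal.span_scale ideal.span_base) auto
    ultimately show "ideal.span {linform 1 0, linform 0 1} \<subseteq> ?I"
      by (intro ideal.span_minimal) auto
  qed
  ultimately show ?thesis by simp
qed

lemma form_ideal_linforms:
  assumes "(x1, y1) \<noteq> (0, 0)" "(x2, y2) \<noteq> (0, 0)"
    and "linform a1 b1 * linform a4 b4 - linform a2 b2 * linform a3 b3 = linform x1 y1 * linform x2 y2"
    and "a2 * b4 - b2 * a4 \<noteq> 0"
    and "i1 + j1 = 2" "i2 + j2 = 2" "(i1, j1) \<noteq> (i2, j2)"
  shows "form_ideal (linform a1 b1) (linform a2 b2) (linform a3 b3) (linform a4 b4)
    (linform x1 y1) (linform x2 y2) {x. bicoeff x 0 0 = 0} i1 j1 i2 j2"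
proof
  show "prime_ideal {x :: 'a poly poly. bicoeff x 0 0 = 0}"
    using prime_ideal_vimage[OF unital_hom_bicoeff_0 prime_ideal_zero] by (simp add: vimage_def)
  \<comment> \<open>A linear form dividing both entries of the second column would be proportional
    to each of them, against their independence.\<close>
  have not_dvd: "\<not> (linform x y dvd linform a2 b2 \<and> linform x y dvd linform a4 b4)"
    if "(x, y) \<noteq> (0, 0)" for x y
  proof
    assume "linform x y dvd linform a2 b2 \<and> linform x y dvd linform a4 b4"
    then have "x * b2 = y * a2" "x * b4 = y * a4"
      by (auto dest: linform_dvd_linform)
    then have "x * (a2 * b4 - b2 * a4) = 0" "y * (a2 * b4 - b2 * a4) = 0"
      by algebra+
    then show False
      using that assms(4) by simp
  qed
  show "\<not> (linform x1 y1 dvd linform a2 b2 \<and> linform x1 y1 dvd linform a4 b4)"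
    "\<not> (linform x2 y2 dvd linform a2 b2 \<and> linform x2 y2 dvd linform a4 b4)"
    using not_dvd assms(1,2) by auto
qed (use assms in \<open>simp_all add: bicoeff_linform prime_elem_linform\<close>)


section \<open>Homomorphisms out of the polynomial ring\<close>

lemma pol_induct [case_names single add]:
  fixes p :: "'k::field pol"
  assumes "\<And>e c. P (Poly_Mapping.single e c)" and "\<And>p q. P p \<Longrightarrow> P q \<Longrightarrow> P (p + q)"
  shows "P p"
proof (induction p rule: update_induct)
  case const
  then show ?case using assms(1)[of 0 0] by simp
next
  case (update f e c)
  have "Poly_Mapping.update e c f = f + Poly_Mapping.single e c"
    using update(1)
    by (intro poly_mapping_eqI) (auto simp: lookup_update lookup_add lookup_single in_keys_iff)
  then show ?case using update assms by metis
qed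

lemma UNIV_var: "UNIV = {S, T, U, V}"
  using var.exhaust by auto

definition monomial_value :: "(var \<Rightarrow> 'a::comm_ring_1) \<Rightarrow> (var \<Rightarrow>\<^sub>0 nat) \<Rightarrow> 'a" where
  "monomial_value \<sigma> e = \<sigma> S ^ Poly_Mapping.lookup e S * \<sigma> T ^ Poly_Mapping.lookup e T *
     \<sigma> U ^ Poly_Mapping.lookup e U * \<sigma> V ^ Poly_Mapping.lookup e V"

text \<open>Substitution with the coefficient map as a parameter: the identity gives evaluation at a
  point, \<open>Const\<close> gives substitution of polynomials, and the embedding of constants
  gives the map to iterated polynomials.\<close>

definition insertion :: "('k::field \<Rightarrow> 'a::comm_ring_1) \<Rightarrow> (var \<Rightarrow> 'a) \<Rightarrow> 'k pol \<Rightarrow> 'a" where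
  "insertion f \<sigma> p =
     (\<Sum>e\<in>Poly_Mapping.keys p. f (Poly_Mapping.lookup p e) * monomial_value \<sigma> e)"

lemma insertion_superset:
  assumes "f 0 = 0" "finite A" "Poly_Mapping.keys p \<subseteq> A"
  shows "insertion f \<sigma> p = (\<Sum>e\<in>A. f (Poly_Mapping.lookup p e) * monomial_value \<sigma> e)"
  unfolding insertion_def using assms
  by (intro sum.mono_neutral_left) (auto simp: in_keys_iff)

lemma insertion_single: "f 0 = 0 \<Longrightarrow> insertion f \<sigma> (Poly_Mapping.single e c) = f c * monomial_value \<sigma> e"
  by (subst insertion_superset[of f "{e}"]) auto

lemma monomial_value_add: "monomial_value \<sigma> (d + e) = monomial_value \<sigma> d * monomial_value \<sigma> e"
  by (simp add: monomial_value_def lookup_add power_add mult_ac)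

lemma unital_hom_insertion:
  assumes f: "unital_hom f"
  shows "unital_hom (insertion f \<sigma>)"
proof -
  note [simp] = unital_homD[OF f]
  have add: "insertion f \<sigma> (p + q) = insertion f \<sigma> p + insertion f \<sigma> q" for p q
  proof -
    let ?A = "Poly_Mapping.keys p \<union> Poly_Mapping.keys q"
    have "Poly_Mapping.keys (p + q) \<subseteq> ?A"
      by (rule Poly_Mapping.keys_add)
    then show ?thesis
      by (simp add: insertion_superset[of f ?A] lookup_add distrib_right sum.distrib)
  qed
  have "insertion f \<sigma> (p * q) = insertion f \<sigma> p * insertion f \<sigma> q" for p q
  proof (induction p rule: pol_induct)
    case (single d c)
    show ?case
      by (induction q rule: pol_induct)
         (simp_all add: add distrib_left distrib_right mult_single insertion_single monomial_value_add mult_ac)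
  qed (simp add: add distrib_right)
  moreover have "insertion f \<sigma> 1 = 1"
    using insertion_single[of f \<sigma> 0 1] by (simp add: monomial_value_def)
  ultimately show ?thesis
    using add by (simp add: unital_hom_def)
qed

lemma unital_hom_Const: "unital_hom (Const :: 'k::field \<Rightarrow> 'k pol)"
  by (simp add: unital_hom_def Const_def single_add mult_single)

lemmas Const_simps = unital_homD[OF unital_hom_Const]

lemma unital_hom_id: "unital_hom (\<lambda>x. x)"
  by (simp add: unital_hom_def)

lemma insertion_Const: "unital_hom f \<Longrightarrow> insertion f \<sigma> (Const c) = f c"
  by (simp add: Const_def insertion_single unital_homD monomial_value_def)

lemma insertion_Var: "unital_hom f \<Longrightarrow> insertion f \<sigma> (Var x) = \<sigma> x"
  by (cases x) (simp_all add: Var_def insertion_single unital_homD monomial_value_def lookup_single)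

lemma eval_pol_eq_insertion: "eval_pol a = insertion (\<lambda>c. c) a"
proof
  fix p
  have "(\<Prod>x\<in>Poly_Mapping.keys e. a x ^ Poly_Mapping.lookup e x) = monomial_value a e" for e
  proof -
    have "(\<Prod>x\<in>Poly_Mapping.keys e. a x ^ Poly_Mapping.lookup e x) =
        (\<Prod>x\<in>{S, T, U, V}. a x ^ Poly_Mapping.lookup e x)"
    proof (rule prod.mono_neutral_left)
      show "Poly_Mapping.keys e \<subseteq> {S, T, U, V}"
        unfolding UNIV_var[symmetric] by simp
    qed (auto simp: in_keys_iff)
    then show ?thesis
      by (simp add: monomial_value_def mult_ac)
  qed
  then show "eval_pol a p = insertion (\<lambda>c. c) a p"
    by (simp add: eval_pol_def insertion_def)
qed

lemma unital_hom_eval_pol: "unital_hom (eval_pol a)"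
  unfolding eval_pol_eq_insertion by (intro unital_hom_insertion unital_hom_id)

lemma eval_pol_Const: "eval_pol a (Const c) = c"
  by (simp add: eval_pol_eq_insertion insertion_Const unital_hom_id)

lemma eval_pol_Var: "eval_pol a (Var x) = a x"
  by (simp add: eval_pol_eq_insertion insertion_Var unital_hom_id)

lemma Var_neq_0: "Var x \<noteq> (0 :: 'k::field pol)"
  using eval_pol_Var[of "\<lambda>_. 1 :: 'k" x] unital_homD(4)[OF unital_hom_eval_pol] by (metis zero_neq_one)

lemma Var_power: "Var x ^ n = Poly_Mapping.single (Poly_Mapping.single x n) 1"
  by (induction n) (simp_all add: Var_def mult_single flip: single_add)

lemma single_eq_monomial:
  "Poly_Mapping.single e c = Const c * monomial_value Var e"
proof -
  have "e = Poly_Mapping.single S (Poly_Mapping.lookup e S) + Poly_Mapping.single T (Poly_Mapping.lookup e T)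
    + Poly_Mapping.single U (Poly_Mapping.lookup e U) + Poly_Mapping.single V (Poly_Mapping.lookup e V)"
  proof (rule poly_mapping_eqI)
    show "Poly_Mapping.lookup e k = Poly_Mapping.lookup (Poly_Mapping.single S (Poly_Mapping.lookup e S) + Poly_Mapping.single T (Poly_Mapping.lookup e T)
    + Poly_Mapping.single U (Poly_Mapping.lookup e U) + Poly_Mapping.single V (Poly_Mapping.lookup e V)) k" for k
      by (cases k) (simp_all add: lookup_add lookup_single)
  qed
  then show ?thesis
    by (simp add: monomial_value_def Var_power Const_def mult_single)
qed

lemma unital_hom_pol_eqI:
  assumes g: "unital_hom g" and h: "unital_hom h"
    and "\<And>c. g (Const c) = h (Const c)" "\<And>x. g (Var x) = h (Var x)"
  shows "g p = h p"
  by (induction p rule: pol_induct)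
     (simp_all add: single_eq_monomial monomial_value_def assms unital_homD[OF g] unital_homD[OF h]
       unital_hom_power[OF g] unital_hom_power[OF h])

lemma unital_hom_poly_eval:
  assumes f: "unital_hom f"
  shows "unital_hom (\<lambda>p. poly (map_poly f p) x)"
proof -
  let ?E = "\<lambda>p. poly (map_poly f p) x"
  note [simp] = unital_homD[OF f]
  have pCons: "?E (pCons a p) = f a + x * ?E p" for a p
    by (simp add: map_poly_pCons)
  have add: "?E (p + q) = ?E p + ?E q" for p q
    by (induction p q rule: poly_induct2) (simp_all add: pCons algebra_simps)
  have smult: "?E (smult a q) = f a * ?E q" for a q
    by (induction q) (simp_all add: pCons algebra_simps)
  have "?E (p * q) = ?E p * ?E q" for p q
    by (induction p) (simp_all add: pCons add smult algebra_simps)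
  moreover have "?E 1 = 1"
    by (simp add: one_pCons pCons)
  ultimately show ?thesis
    using add by (simp add: unital_hom_def)
qed

lemma unital_hom_const_poly: "unital_hom (\<lambda>c :: 'a::comm_ring_1. [:c:])"
  by (simp add: unital_hom_def one_pCons)

lemma unital_hom_poly_eqI:
  assumes g: "unital_hom g" and h: "unital_hom h"
    and "\<And>c. g [:c:] = h [:c:]" "g [:0, 1:] = h [:0, 1:]"
  shows "g p = h p"
proof (induction p)
  case (pCons c p)
  have "pCons c p = [:c:] + [:0, 1:] * p"
    by simp
  then show ?case
    using pCons assms(3,4) by (metis unital_homD(2,3)[OF g] unital_homD(2,3)[OF h])
qed (simp add: unital_homD[OF g] unital_homD[OF h])


section \<open>Linear changes of variables\<close>

definition uv_form :: "'k::field \<Rightarrow> 'k \<Rightarrow> 'k pol" where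
  "uv_form a b = Const a * Var U + Const b * Var V"

text \<open>The elements \<open>s'\<close> and \<open>t'\<close> are the images of the outer and inner variable of
  \<open>k[u, v][t'][s']\<close>; the coefficient ring \<open>k[u, v]\<close> is \<open>k[v][u]\<close>.\<close>

definition uv_pol :: "'k::field poly poly \<Rightarrow> 'k pol" where
  "uv_pol c = poly (map_poly (\<lambda>d. poly (map_poly Const d) (Var V)) c) (Var U)"

definition pol_of_bipoly :: "'k::field pol \<Rightarrow> 'k pol \<Rightarrow> 'k poly poly poly poly \<Rightarrow> 'k pol" where
  "pol_of_bipoly s' t' x = poly (map_poly (\<lambda>y. poly (map_poly uv_pol y) t') x) s'"

lemma unital_hom_uv_pol: "unital_hom uv_pol"
  unfolding uv_pol_def by (intro unital_hom_poly_eval unital_hom_Const)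

lemma unital_hom_pol_of_bipoly: "unital_hom (pol_of_bipoly s' t')"
  unfolding pol_of_bipoly_def by (intro unital_hom_poly_eval unital_hom_uv_pol)

lemma uv_pol_linform: "uv_pol (linform a b) = uv_form a b"
  by (simp add: uv_pol_def linform_eq_pCons map_poly_pCons Const_def uv_form_def)

lemma pol_of_bipoly_bimonom:
  "pol_of_bipoly s' t' (bimonom i j c) = s' ^ i * t' ^ j * uv_pol c"
  by (simp add: pol_of_bipoly_def bimonom_def map_poly_monom poly_monom unital_homD[OF unital_hom_uv_pol])

text \<open>The inverse \<open>\<Phi>\<close> is the substitution by the inverse matrix:
  \<open>S\<close> goes to \<open>\<alpha> s' - \<beta> t'\<close> and \<open>T\<close> to
  \<open>\<delta> t' - \<gamma> s'\<close>. Both composites are homomorphisms and are compared with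
  the identity on constants and variables.\<close>

lemma bij_pol_of_bipoly:
  fixes a b c d :: "'k::field"
  assumes D: "a * d - b * c \<noteq> 0"
    and s': "s' = Const a * Var S + Const b * Var T" and t': "t' = Const c * Var S + Const d * Var T"
  shows "bij (pol_of_bipoly s' t')"
proof -
  define D where "D = a * d - b * c"
  define \<alpha> \<beta> \<gamma> \<delta> where "\<alpha> = d / D" and "\<beta> = b / D" and "\<gamma> = c / D" and "\<delta> = a / D"
  have "D \<noteq> 0"
    using D by (simp add: D_def)
  then have inv: "\<alpha> * a - \<beta> * c = 1" "\<delta> * d - \<gamma> * b = 1"
    "\<alpha> * b - \<beta> * d = 0" "\<delta> * c - \<gamma> * a = 0" "\<alpha> * a - \<gamma> * b = 1" "\<delta> * d - \<beta> * c = 1"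
    "\<delta> * b - \<beta> * a = 0" "\<alpha> * c - \<gamma> * d = 0"
    by (simp_all add: \<alpha>_def \<beta>_def \<gamma>_def \<delta>_def divide_simps) (simp_all add: D_def algebra_simps)
  let ?\<iota> = "\<lambda>x :: 'k. [:[:[:[:x:]:]:]:]"
  define \<sigma> where "\<sigma> x = (case x of
      S \<Rightarrow> ?\<iota> \<alpha> * bimonom 1 0 1 - ?\<iota> \<beta> * bimonom 0 1 1
    | T \<Rightarrow> ?\<iota> \<delta> * bimonom 0 1 1 - ?\<iota> \<gamma> * bimonom 1 0 1
    | U \<Rightarrow> bimonom 0 0 (linform 1 0)
    | V \<Rightarrow> bimonom 0 0 (linform 0 1))" for x
  define \<Phi> where "\<Phi> = insertion ?\<iota> \<sigma>"
  let ?\<Theta> = "pol_of_bipoly s' t'"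
  have \<iota>: "unital_hom ?\<iota>"
    by (intro unital_hom_comp[OF unital_hom_const_poly] unital_hom_const_poly)
  have \<Phi>: "unital_hom \<Phi>"
    unfolding \<Phi>_def by (intro unital_hom_insertion \<iota>)
  have \<Theta>: "unital_hom ?\<Theta>"
    by (rule unital_hom_pol_of_bipoly)
  note C = Const_simps
  have \<Theta>\<iota>: "?\<Theta> (?\<iota> x) = Const x" for x
    by (simp add: pol_of_bipoly_def uv_pol_def map_poly_pCons C)
  have \<Phi>_Const: "\<Phi> (Const x) = ?\<iota> x" and \<Phi>_Var: "\<Phi> (Var z) = \<sigma> z" for x z
    by (simp_all add: \<Phi>_def insertion_Const insertion_Var \<iota>)
  have \<Theta>_gens: "?\<Theta> (bimonom 1 0 1) = s'" "?\<Theta> (bimonom 0 1 1) = t'"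
    "?\<Theta> (bimonom 0 0 (linform 1 0)) = Var U" "?\<Theta> (bimonom 0 0 (linform 0 1)) = Var V"
    by (simp_all add: pol_of_bipoly_bimonom uv_pol_linform uv_form_def unital_homD[OF unital_hom_uv_pol] C)
  have inv1: "?\<Theta> (\<Phi> p) = p" for p
  proof (rule unital_hom_pol_eqI)
    show "unital_hom (\<lambda>p. ?\<Theta> (\<Phi> p))"
      by (rule unital_hom_comp[OF \<Theta> \<Phi>])
    show "?\<Theta> (\<Phi> (Const x)) = Const x" for x
      by (simp only: \<Phi>_Const \<Theta>\<iota>)
    have "Const \<alpha> * s' - Const \<beta> * t' = Const (\<alpha> * a - \<beta> * c) * Var S + Const (\<alpha> * b - \<beta> * d) * Var T"
      by (simp add: s' t' C algebra_simps)
    then have S: "Const \<alpha> * s' - Const \<beta> * t' = Var S"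
      unfolding inv by (simp add: C)
    have "Const \<delta> * t' - Const \<gamma> * s' = Const (\<delta> * c - \<gamma> * a) * Var S + Const (\<delta> * d - \<gamma> * b) * Var T"
      by (simp add: s' t' C algebra_simps)
    then have T: "Const \<delta> * t' - Const \<gamma> * s' = Var T"
      unfolding inv by (simp add: C)
    show "?\<Theta> (\<Phi> (Var z)) = Var z" for z
      using S T unfolding \<Phi>_Var \<sigma>_def
      by (cases z) (simp_all only: var.case unital_homD[OF \<Theta>] \<Theta>_gens \<Theta>\<iota>)
  qed (rule unital_hom_id)
  have inv2: "\<Phi> (?\<Theta> x) = x" for x
  proof -
    note const = unital_hom_const_poly
    have \<Phi>\<Theta>: "unital_hom (\<lambda>x. \<Phi> (?\<Theta> x))"
      by (rule unital_hom_comp[OF \<Phi> \<Theta>])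
    have s: "\<Phi> s' = bimonom 1 0 1"
    proof -
      have "\<Phi> s' = ?\<iota> (\<alpha> * a - \<gamma> * b) * bimonom 1 0 1 + ?\<iota> (\<delta> * b - \<beta> * a) * bimonom 0 1 1"
        unfolding s' unital_homD[OF \<Phi>] \<Phi>_Const \<Phi>_Var \<sigma>_def var.case unital_homD[OF \<iota>]
        by (simp only: algebra_simps)
      then show ?thesis
        unfolding inv using unital_homD[OF \<iota>] by simp
    qed
    have t: "\<Phi> t' = bimonom 0 1 1"
    proof -
      have "\<Phi> t' = ?\<iota> (\<alpha> * c - \<gamma> * d) * bimonom 1 0 1 + ?\<iota> (\<delta> * d - \<beta> * c) * bimonom 0 1 1"
        unfolding t' unital_homD[OF \<Phi>] \<Phi>_Const \<Phi>_Var \<sigma>_def var.case unital_homD[OF \<iota>]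
        by (simp only: algebra_simps)
      then show ?thesis
        unfolding inv using unital_homD[OF \<iota>] by simp
    qed
    have X: "[:0, 1:] = bimonom 1 0 (1 :: 'k poly poly)" "[:[:0, 1:]:] = bimonom 0 1 (1 :: 'k poly poly)"
      "[:[:[:0, 1:]:]:] = bimonom 0 0 (linform 1 (0 :: 'k))"
      "[:[:[:[:0, 1:]:]:]:] = bimonom 0 0 (linform 0 (1 :: 'k))"
      by (simp_all add: bimonom_def monom_Suc monom_0 linform_eq_pCons one_pCons)
    \<comment> \<open>The identity is extended one polynomial layer at a time: constants first, then
      adjoining \<open>v\<close>, \<open>u\<close>, \<open>t'\<close> and finally
      \<open>s'\<close>.\<close>
    have 1: "\<Phi> (?\<Theta> [:[:[:[:y:]:]:]:]) = [:[:[:[:y:]:]:]:]" for y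
      by (simp only: \<Theta>\<iota> \<Phi>_Const)
    have 2: "\<Phi> (?\<Theta> [:[:[:y:]:]:]) = [:[:[:y:]:]:]" for y
    proof (rule unital_hom_poly_eqI[of "\<lambda>y. \<Phi> (?\<Theta> [:[:[:y:]:]:])" "\<lambda>y. [:[:[:y:]:]:]"])
      show "unital_hom (\<lambda>y. \<Phi> (?\<Theta> [:[:[:y:]:]:]))" "unital_hom (\<lambda>y :: 'k poly. [:[:[:y:]:]:])"
        by (intro unital_hom_comp[OF \<Phi>\<Theta>] unital_hom_comp[OF const] const)+
    qed (simp_all only: 1 X \<Theta>_gens \<Phi>_Var \<sigma>_def var.case)
    have 3: "\<Phi> (?\<Theta> [:[:y:]:]) = [:[:y:]:]" for y
    proof (rule unital_hom_poly_eqI[of "\<lambda>y. \<Phi> (?\<Theta> [:[:y:]:])" "\<lambda>y. [:[:y:]:]"])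
      show "unital_hom (\<lambda>y. \<Phi> (?\<Theta> [:[:y:]:]))" "unital_hom (\<lambda>y :: 'k poly poly. [:[:y:]:])"
        by (intro unital_hom_comp[OF \<Phi>\<Theta>] unital_hom_comp[OF const] const)+
    qed (simp_all only: 2 X \<Theta>_gens \<Phi>_Var \<sigma>_def var.case)
    have 4: "\<Phi> (?\<Theta> [:y:]) = [:y:]" for y
    proof (rule unital_hom_poly_eqI[of "\<lambda>y. \<Phi> (?\<Theta> [:y:])" "\<lambda>y. [:y:]"])
      show "unital_hom (\<lambda>y. \<Phi> (?\<Theta> [:y:]))" "unital_hom (\<lambda>y :: 'k poly poly poly. [:y:])"
        by (intro unital_hom_comp[OF \<Phi>\<Theta>] unital_hom_comp[OF const] const)+
    qed (simp_all only: 3 X \<Theta>_gens t)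
    show ?thesis
    proof (rule unital_hom_poly_eqI[of "\<lambda>x. \<Phi> (?\<Theta> x)" "\<lambda>x. x"])
      show "unital_hom (\<lambda>x. \<Phi> (?\<Theta> x))" by (fact \<Phi>\<Theta>)
    qed (simp_all only: 4 X \<Theta>_gens s unital_hom_id)
  qed
  show ?thesis
    using inv1 inv2 by (rule_tac o_bij[of \<Phi>]) auto
qed

text \<open>Iterated polynomials over a field form a domain; the isomorphism for the identity change
  of variables carries this over.\<close>

lemma pol_mult_eq_0_iff:
  fixes p q :: "'k::field pol"
  shows "p * q = 0 \<longleftrightarrow> p = 0 \<or> q = 0"
proof -
  let ?\<Theta> = "pol_of_bipoly (Const 1 * Var S + Const 0 * Var T) (Const 0 * Var S + Const (1 :: 'k) * Var T)"
  have bij: "bij ?\<Theta>"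
    by (rule bij_pol_of_bipoly[of 1 1 0 0]) simp_all
  have hom: "unital_hom ?\<Theta>"
    by (rule unital_hom_pol_of_bipoly)
  obtain x y where xy: "p = ?\<Theta> x" "q = ?\<Theta> y"
    using bij by (metis bij_pointE)
  have 0: "?\<Theta> z = 0 \<longleftrightarrow> z = 0" for z
    using bij unital_homD(4)[OF hom] by (metis bij_pointE)
  show ?thesis
    unfolding xy unital_homD(3)[OF hom, symmetric] 0 by simp
qed

lemma pol_mult_cancel_left: "p * q = p * r \<longleftrightarrow> p = 0 \<or> q = r" for p q r :: "'k::field pol"
  using pol_mult_eq_0_iff[of p "q - r"] by (simp add: right_diff_distrib)


section \<open>Forms of small bidegree\<close>

definition st_quadratic :: "'k::field pol \<Rightarrow> 'k pol \<Rightarrow> 'k \<Rightarrow> 'k \<Rightarrow> 'k \<Rightarrow> 'k pol" where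
  "st_quadratic x y a b c = Const a * x\<^sup>2 + Const b * (x * y) + Const c * y\<^sup>2"

lemma uv_form_add: "uv_form a b + uv_form c d = uv_form (a + c) (b + d)"
  by (simp add: uv_form_def Const_simps algebra_simps)

lemma uv_form_scale: "Const c * uv_form a b = uv_form (c * a) (c * b)"
  by (simp add: uv_form_def Const_simps algebra_simps)

lemma uv_form_0: "uv_form 0 0 = 0"
  by (simp add: uv_form_def Const_simps)

lemma bigraded_add: "p \<in> bigraded m n \<Longrightarrow> q \<in> bigraded m n \<Longrightarrow> p + q \<in> bigraded m n"
  using Poly_Mapping.keys_add[of p q] by (fastforce simp: bigraded_def)

lemma uv_form_bigraded: "uv_form a b \<in> bigraded 0 1"
proof -
  have "Const c * Var x \<in> bigraded 0 1" if "x = U \<or> x = V" for c :: 'a and x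
    using that by (auto simp: bigraded_def Const_def Var_def mult_single lookup_single)
  then show ?thesis
    unfolding uv_form_def by (intro bigraded_add) auto
qed

lemma pol_sum_of_terms:
  "(\<Sum>e\<in>Poly_Mapping.keys p. Const (Poly_Mapping.lookup p e) * monomial_value Var e) = p"
proof -
  have "insertion Const Var p = p"
    by (rule unital_hom_pol_eqI[OF unital_hom_insertion[OF unital_hom_Const] unital_hom_id])
       (simp_all add: insertion_Const insertion_Var unital_hom_Const)
  then show ?thesis
    by (simp add: insertion_def)
qed

lemma bigraded_induct [consumes 1, case_names zero monom add]:
  assumes "p \<in> bigraded m n"
    and "P 0"
    and "\<And>e c. Poly_Mapping.lookup e S + Poly_Mapping.lookup e T = m \<Longrightarrow>
           Poly_Mapping.lookup e U + Poly_Mapping.lookup e V = n \<Longrightarrow> P (Const c * monomial_value Var e)"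
    and add: "\<And>p q. P p \<Longrightarrow> P q \<Longrightarrow> P (p + q)"
  shows "P p"
proof -
  have "P (\<Sum>e\<in>A. Const (Poly_Mapping.lookup p e) * monomial_value Var e)"
    if "finite A" "A \<subseteq> Poly_Mapping.keys p" for A
    using that assms(1) by (induction A rule: finite_induct) (auto intro!: assms simp: bigraded_def)
  from this[of "Poly_Mapping.keys p"] show ?thesis
    by (simp add: pol_sum_of_terms)
qed

lemma bigraded_0_1_iff: "L \<in> bigraded 0 1 \<longleftrightarrow> (\<exists>a b. L = uv_form a b)"
proof
  show "\<exists>a b. L = uv_form a b" if "L \<in> bigraded 0 1"
    using that
  proof (induction rule: bigraded_induct)
    case zero
    show ?case by (metis uv_form_0)
  next
    case (monom e c)
    then have "Poly_Mapping.lookup e U = 1 \<and> Poly_Mapping.lookup e V = 0 \<or>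
        Poly_Mapping.lookup e U = 0 \<and> Poly_Mapping.lookup e V = 1"
      by auto
    then have "Const c * monomial_value Var e = uv_form c 0 \<or> Const c * monomial_value Var e = uv_form 0 c"
      using monom(1) by (auto simp: monomial_value_def uv_form_def Const_simps)
    then show ?case by blast
  next
    case (add p q)
    then show ?case by (metis uv_form_add)
  qed
qed (use uv_form_bigraded in blast)

lemma bigraded_2_1_cases:
  assumes "p \<in> bigraded 2 1"
  obtains a b c a' b' c' where
    "p = (Var S)\<^sup>2 * uv_form a a' + Var S * Var T * uv_form b b' + (Var T)\<^sup>2 * uv_form c c'"
proof -
  from assms have "\<exists>a a' b b' c c'.
      p = (Var S)\<^sup>2 * uv_form a a' + Var S * Var T * uv_form b b' + (Var T)\<^sup>2 * uv_form c c'" (is "?Q p")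
  proof (induction rule: bigraded_induct)
    case zero
    have "0 = (Var S)\<^sup>2 * uv_form 0 0 + Var S * Var T * uv_form 0 0 + (Var T)\<^sup>2 * uv_form 0 0"
      by (simp add: uv_form_0)
    then show ?case by blast
  next
    case (monom e k)
    let ?l = "Poly_Mapping.lookup e"
    have "?l S = 2 \<and> ?l T = 0 \<or> ?l S = 1 \<and> ?l T = 1 \<or> ?l S = 0 \<and> ?l T = 2"
      using monom(1) by auto
    then have st: "(Var S ^ ?l S * Var T ^ ?l T :: 'a pol) \<in> {(Var S)\<^sup>2, Var S * Var T, (Var T)\<^sup>2}"
      by auto
    have "?l U = 1 \<and> ?l V = 0 \<or> ?l U = 0 \<and> ?l V = 1"
      using monom(2) by auto
    then have "Const k * (Var U ^ ?l U * Var V ^ ?l V) = uv_form k 0 \<or>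
        Const k * (Var U ^ ?l U * Var V ^ ?l V) = uv_form 0 k"
      by (auto simp: uv_form_def Const_simps)
    then obtain a a' where uv: "Const k * (Var U ^ ?l U * Var V ^ ?l V) = uv_form a a'"
      by blast
    have "Const k * monomial_value Var e =
        (Var S ^ ?l S * Var T ^ ?l T) * (Const k * (Var U ^ ?l U * Var V ^ ?l V))"
      by (simp add: monomial_value_def mult_ac)
    then have eq: "Const k * monomial_value Var e = (Var S ^ ?l S * Var T ^ ?l T) * uv_form a a'"
      by (simp only: uv)
    have "(Var S)\<^sup>2 * uv_form a a' = (Var S)\<^sup>2 * uv_form a a' + Var S * Var T * uv_form 0 0 + (Var T)\<^sup>2 * uv_form 0 0"
      "Var S * Var T * uv_form a a' = (Var S)\<^sup>2 * uv_form 0 0 + Var S * Var T * uv_form a a' + (Var T)\<^sup>2 * uv_form 0 0"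
      "(Var T)\<^sup>2 * uv_form a a' = (Var S)\<^sup>2 * uv_form 0 0 + Var S * Var T * uv_form 0 0 + (Var T)\<^sup>2 * uv_form a a'"
      by (simp_all add: uv_form_0)
    then have Q: "?Q ((Var S)\<^sup>2 * uv_form a a')" "?Q (Var S * Var T * uv_form a a')" "?Q ((Var T)\<^sup>2 * uv_form a a')"
      by blast+
    from st consider "(Var S ^ ?l S * Var T ^ ?l T :: 'a pol) = (Var S)\<^sup>2"
      | "(Var S ^ ?l S * Var T ^ ?l T :: 'a pol) = Var S * Var T"
      | "(Var S ^ ?l S * Var T ^ ?l T :: 'a pol) = (Var T)\<^sup>2"
      by blast
    then show ?case
      unfolding eq by cases (simp_all only: Q)
  next
    case (add p q)
    then obtain a a' b b' c c' d d' e e' f f' where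
      p: "p = (Var S)\<^sup>2 * uv_form a a' + Var S * Var T * uv_form b b' + (Var T)\<^sup>2 * uv_form c c'" and
      q: "q = (Var S)\<^sup>2 * uv_form d d' + Var S * Var T * uv_form e e' + (Var T)\<^sup>2 * uv_form f f'"
      by blast
    have "p + q = (Var S)\<^sup>2 * uv_form (a + d) (a' + d') + Var S * Var T * uv_form (b + e) (b' + e') +
        (Var T)\<^sup>2 * uv_form (c + f) (c' + f')"
      unfolding p q uv_form_add[symmetric] by (simp add: algebra_simps)
    then show ?case by blast
  qed
  then show thesis using that by blast
qed

text \<open>The right-hand sides are the coefficients of \<open>(x X + y Y) (z X + w Y)\<close>. A
  root \<open>r\<close> of the dehomogenized form splits off \<open>X - r Y\<close>; if
  \<open>a = 0\<close>, the factor is \<open>Y\<close>.\<close>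

lemma binary_quadratic_factorization:
  fixes a b c :: "'k::alg_closed_field"
  obtains x y z w where "a = x * z" "b = x * w + y * z" "c = y * w"
proof (cases "a = 0")
  case True
  then show thesis
    using that[of 0 b c 1] by simp
next
  case False
  then have "degree [:c, b, a:] > 0" by simp
  then obtain r where "poly [:c, b, a:] r = 0"
    using alg_closed_imp_poly_has_root by blast
  then have "c + r * (b + a * r) = 0"
    by (simp add: algebra_simps)
  then have "c = (- r) * (b + a * r)"
    by (simp add: eq_neg_iff_add_eq_0)
  then show thesis
    using that[of 1 a "b + a * r" "- r"] by simp
qed

lemma proportional_pairs:
  fixes x y z w :: "'k::field"
  assumes "x * w = y * z" "(x, y) \<noteq> (0, 0)" "(z, w) \<noteq> (0, 0)"
  obtains c where "c \<noteq> 0" "x = c * z" "y = c * w"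
proof (cases "z = 0")
  case False
  have "x \<noteq> 0"
    using assms False by auto
  then show thesis
    using that[of "x / z"] assms False by (simp add: field_simps)
next
  case True
  then have w: "w \<noteq> 0" "x = 0"
    using assms by auto
  then show thesis
    using that[of "y / w"] assms True by simp
qed


section \<open>The normal form\<close>

lemma st_product_expand:
  assumes "s = Const a * s' + Const b * t'" "t = Const c * s' + Const d * t'"
  shows "s\<^sup>2 = Const (a * a) * s'\<^sup>2 + Const (a * b + b * a) * (s' * t') + Const (b * b) * t'\<^sup>2"
    "s * t = Const (a * c) * s'\<^sup>2 + Const (a * d + b * c) * (s' * t') + Const (b * d) * t'\<^sup>2"
    "t\<^sup>2 = Const (c * c) * s'\<^sup>2 + Const (c * d + d * c) * (s' * t') + Const (d * d) * t'\<^sup>2"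
  unfolding assms Const_simps(2,3) by (simp_all only: power2_eq_square algebra_simps)

lemma bigraded_2_1_new_variables:
  assumes D: "a * d - b * c \<noteq> 0"
    and s': "s' = Const a * Var S + Const b * Var T" and t': "t' = Const c * Var S + Const d * Var T"
    and p: "p \<in> bigraded 2 1"
  obtains x x' y y' z z' where
    "p = s'\<^sup>2 * uv_form x x' + s' * t' * uv_form y y' + t'\<^sup>2 * uv_form z z'"
proof -
  define D where "D = a * d - b * c"
  have D0: "D \<noteq> 0"
    using D by (simp add: D_def)
  then have inv: "d / D * a + - b / D * c = 1" "d / D * b + - b / D * d = 0"
    "- c / D * a + a / D * c = 0" "- c / D * b + a / D * d = 1"
    by (simp_all add: divide_simps) (simp_all add: D_def algebra_simps)
  have "Const (d / D) * s' + Const (- b / D) * t' =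
      Const (d / D * a + - b / D * c) * Var S + Const (d / D * b + - b / D * d) * Var T"
    unfolding s' t' Const_simps(2,3) by (simp only: algebra_simps)
  then have S: "Var S = Const (d / D) * s' + Const (- b / D) * t'"
    unfolding inv by (simp add: Const_simps)
  have "Const (- c / D) * s' + Const (a / D) * t' =
      Const (- c / D * a + a / D * c) * Var S + Const (- c / D * b + a / D * d) * Var T"
    unfolding s' t' Const_simps(2,3) by (simp only: algebra_simps)
  then have T: "Var T = Const (- c / D) * s' + Const (a / D) * t'"
    unfolding inv by (simp add: Const_simps)
  obtain e f g e' f' g' where
    "p = (Var S)\<^sup>2 * uv_form e e' + Var S * Var T * uv_form f f' + (Var T)\<^sup>2 * uv_form g g'"
    using p by (rule bigraded_2_1_cases)
  moreover define \<alpha> \<beta> \<gamma> \<delta> where "\<alpha> = d / D" "\<beta> = - b / D" "\<gamma> = - c / D" "\<delta> = a / D"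
  ultimately have "p = s'\<^sup>2 * (Const (\<alpha> * \<alpha>) * uv_form e e' + Const (\<alpha> * \<gamma>) * uv_form f f' + Const (\<gamma> * \<gamma>) * uv_form g g') +
      s' * t' * (Const (\<alpha> * \<beta> + \<beta> * \<alpha>) * uv_form e e' + Const (\<alpha> * \<delta> + \<beta> * \<gamma>) * uv_form f f' +
        Const (\<gamma> * \<delta> + \<delta> * \<gamma>) * uv_form g g') +
      t'\<^sup>2 * (Const (\<beta> * \<beta>) * uv_form e e' + Const (\<beta> * \<delta>) * uv_form f f' + Const (\<delta> * \<delta>) * uv_form g g')"
    using st_product_expand[OF S T] by (simp only:) (simp only: algebra_simps)
  then show thesis
    unfolding uv_form_scale uv_form_add by (rule that)
qed

text \<open>Sorting a syzygy by \<open>u\<close> and \<open>v\<close> gives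
  \<open>u P + v Q = 0\<close> with \<open>P\<close>, \<open>Q\<close> in \<open>W\<close>; this
  forces \<open>P = h v\<close> and \<open>Q = - h u\<close>. If \<open>h\<close> were 0, the
  independence of the four generators would make the syzygy trivial.\<close>

lemma syzygy_quadratic:
  fixes p :: "nat \<Rightarrow> 'k::field pol"
  assumes W: "W = kspace.span (p ` {..<4})" and W21: "W \<subseteq> bigraded 2 1" and dim: "kspace.dim W = 4"
    and syz: "first_syzygy p 0 1 g"
  obtains a b c where "(a, b, c) \<noteq> (0, 0, 0)"
    "st_quadratic (Var S) (Var T) a b c * Var U \<in> W" "st_quadratic (Var S) (Var T) a b c * Var V \<in> W"
proof -
  from syz have "\<forall>i<4. g i \<in> bigraded 0 1"
    unfolding first_syzygy_def by blast
  then have "\<forall>i<4. \<exists>x y. g i = uv_form x y"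
    by (simp only: bigraded_0_1_iff)
  then obtain x y where g: "\<And>i. i < 4 \<Longrightarrow> g i = uv_form (x i) (y i)"
    by metis
  define P Q where "P = (\<Sum>i<4. kscale (x i) (p i))" and "Q = (\<Sum>i<4. kscale (y i) (p i))"
  have "kscale c (p i) \<in> W" if "i < 4" for c i
    using that unfolding W by (intro kspace.span_scale kspace.span_base) auto
  then have PQ_W: "P \<in> W" "Q \<in> W"
    unfolding P_def Q_def W by (auto intro!: kspace.span_sum)
  have "(\<Sum>i<4. g i * p i) = (\<Sum>i<4. Var U * kscale (x i) (p i) + Var V * kscale (y i) (p i))"
    by (intro sum.cong) (auto simp: g uv_form_def kscale_def algebra_simps)
  then have UV: "Var U * P + Var V * Q = 0"
    using syz by (simp add: first_syzygy_def P_def Q_def sum.distrib sum_distrib_left)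
  obtain a b c a' b' c' where P:
    "P = (Var S)\<^sup>2 * uv_form a a' + Var S * Var T * uv_form b b' + (Var T)\<^sup>2 * uv_form c c'"
    using PQ_W W21 by (meson bigraded_2_1_cases subsetD)
  obtain d e f d' e' f' where Q:
    "Q = (Var S)\<^sup>2 * uv_form d d' + Var S * Var T * uv_form e e' + (Var T)\<^sup>2 * uv_form f f'"
    using PQ_W W21 by (meson bigraded_2_1_cases subsetD)
  have P': "P = st_quadratic (Var S) (Var T) a b c * Var U + st_quadratic (Var S) (Var T) a' b' c' * Var V"
    unfolding P by (simp add: st_quadratic_def uv_form_def algebra_simps)
  have Q': "Q = st_quadratic (Var S) (Var T) d e f * Var U + st_quadratic (Var S) (Var T) d' e' f' * Var V"
    unfolding Q by (simp add: st_quadratic_def uv_form_def algebra_simps)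
  have hom: "unital_hom (insertion Const \<sigma>)" for \<sigma> :: "var \<Rightarrow> 'k pol"
    by (intro unital_hom_insertion unital_hom_Const)
  have ins: "insertion Const \<sigma> (Var U * P + Var V * Q) =
      \<sigma> U * (st_quadratic (\<sigma> S) (\<sigma> T) a b c * \<sigma> U + st_quadratic (\<sigma> S) (\<sigma> T) a' b' c' * \<sigma> V) +
      \<sigma> V * (st_quadratic (\<sigma> S) (\<sigma> T) d e f * \<sigma> U + st_quadratic (\<sigma> S) (\<sigma> T) d' e' f' * \<sigma> V)" for \<sigma>
    unfolding P' Q' st_quadratic_def
    by (simp add: unital_homD[OF hom] unital_hom_power[OF hom] insertion_Const[OF unital_hom_Const]
        insertion_Var[OF unital_hom_Const])
  \<comment> \<open>Setting \<open>v = 0\<close> in the relation leaves \<open>u^2\<close> times the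
    \<open>u\<close>-part of \<open>P\<close>; setting \<open>u = 0\<close> below does the same for
    the \<open>v\<close>-part of \<open>Q\<close>.\<close>
  have "st_quadratic (Var S) (Var T) a b c = 0"
    using ins[of "Var(V := 0)"] unital_homD(4)[OF hom] UV by (simp add: pol_mult_eq_0_iff Var_neq_0)
  moreover have "st_quadratic (Var S) (Var T) d' e' f' = 0"
    using ins[of "Var(U := 0)"] unital_homD(4)[OF hom] UV by (simp add: pol_mult_eq_0_iff Var_neq_0)
  ultimately have P: "P = st_quadratic (Var S) (Var T) a' b' c' * Var V"
    and Q: "Q = st_quadratic (Var S) (Var T) d e f * Var U"
    by (simp_all add: P' Q')
  have "Var V * (st_quadratic (Var S) (Var T) a' b' c' * Var U + Q) = 0"
    using UV by (simp add: P algebra_simps)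
  then have Q2: "Q = - (st_quadratic (Var S) (Var T) a' b' c' * Var U)"
    by (simp add: pol_mult_eq_0_iff Var_neq_0 add_eq_0_iff)
  have "kspace.subspace W"
    by (simp add: W)
  then have "- Q \<in> W"
    using PQ_W(2) by (rule kspace.subspace_neg)
  then have in_W: "st_quadratic (Var S) (Var T) a' b' c' * Var U \<in> W" "st_quadratic (Var S) (Var T) a' b' c' * Var V \<in> W"
    using PQ_W(1) by (simp_all add: Q2 P)
  have "(a', b', c') \<noteq> (0, 0, 0)"
  proof
    assume "(a', b', c') = (0, 0, 0)"
    then have "st_quadratic (Var S) (Var T) a' b' c' = (0 :: 'k pol)"
      by (simp add: st_quadratic_def Const_simps)
    then have 0: "P = 0" "Q = 0"
      by (simp_all add: P Q2)
    \<comment> \<open>A relation with \<open>z i\<close> nonzero would make the other at most three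
      generators span \<open>W\<close>, which has dimension 4.\<close>
    have "z i = 0" if sum: "(\<Sum>i<4. kscale (z i) (p i)) = 0" and "i < 4" for z i
    proof (rule ccontr)
      assume zi: "z i \<noteq> 0"
      let ?B = "p ` ({..<4} - {i})"
      have "(\<Sum>j<4. kscale (z j) (p j)) = kscale (z i) (p i) + (\<Sum>j\<in>{..<4} - {i}. kscale (z j) (p j))"
        using \<open>i < 4\<close> by (intro sum.remove) auto
      then have "kscale (z i) (p i) = - (\<Sum>j\<in>{..<4} - {i}. kscale (z j) (p j))"
        using sum by (simp add: eq_neg_iff_add_eq_0)
      also have "\<dots> \<in> kspace.span ?B"
        by (intro kspace.span_neg kspace.span_sum kspace.span_scale kspace.span_base) auto
      finally have "kscale (inverse (z i)) (kscale (z i) (p i)) \<in> kspace.span ?B"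
        by (rule kspace.span_scale)
      then have pi: "p i \<in> kspace.span ?B"
        using zi by (simp add: kspace.scale_scale)
      have "p ` {..<4} \<subseteq> kspace.span ?B"
      proof
        fix q assume "q \<in> p ` {..<4}"
        then obtain j where "j < 4" "q = p j" by auto
        then show "q \<in> kspace.span ?B"
          using pi by (cases "j = i") (auto intro: kspace.span_base)
      qed
      then have "W \<subseteq> kspace.span ?B"
        unfolding W by (intro kspace.span_minimal) auto
      then have "kspace.dim W \<le> card ?B"
        by (rule kspace.dim_le_card) simp
      also have "\<dots> \<le> card ({..<4} - {i})"
        by (rule card_image_le) simp
      also have "\<dots> < 4"
        using \<open>i < 4\<close> by simp
      finally show False
        using dim by simp
    qed
    then have "x i = 0 \<and> y i = 0" if "i < 4" for i
      using 0 that by (auto simp: P_def Q_def)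
    then have "g i = 0" if "i < 4" for i
      using that by (simp add: g uv_form_0)
    then show False
      using syz by (auto simp: first_syzygy_def)
  qed
  then show thesis
    using in_W that by blast
qed


section \<open>Evaluation and comparison of forms\<close>

lemma eval_pol_simps:
  "eval_pol \<sigma> (x + y) = eval_pol \<sigma> x + eval_pol \<sigma> y" "eval_pol \<sigma> (x * y) = eval_pol \<sigma> x * eval_pol \<sigma> y"
  "eval_pol \<sigma> 0 = 0" "eval_pol \<sigma> (x ^ n) = eval_pol \<sigma> x ^ n" "eval_pol \<sigma> (Const c) = c"
  "eval_pol \<sigma> (Var z) = \<sigma> z" "eval_pol \<sigma> (kscale c x) = c * eval_pol \<sigma> x"
  "eval_pol \<sigma> (uv_form a b) = a * \<sigma> U + b * \<sigma> V"
  by (simp_all add: unital_homD[OF unital_hom_eval_pol] unital_hom_power[OF unital_hom_eval_pol]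
      eval_pol_Const eval_pol_Var kscale_def uv_form_def)

lemma uv_form_eq_iff: "uv_form a b = uv_form c d \<longleftrightarrow> a = c \<and> b = d"
proof
  assume eq: "uv_form a b = uv_form c d"
  have "a * x + b * y = c * x + d * y" for x y
    using arg_cong[OF eq, of "eval_pol (\<lambda>z. if z = U then x else y)"] by (simp add: eval_pol_simps)
  from this[of 1 0] this[of 0 1] show "a = c \<and> b = d"
    by simp
qed simp

lemma uv_form_eq_0_iff: "uv_form a b = 0 \<longleftrightarrow> a = 0 \<and> b = 0"
  using uv_form_eq_iff[of a b 0 0] by (simp add: uv_form_0)

lemma Var_eq_uv_form: "Var U = uv_form 1 0" "Var V = uv_form 0 1"
  by (simp_all add: uv_form_def Const_simps)

lemma st_form_neq_0:
  assumes "(a, b) \<noteq> (0, 0 :: 'k::field)"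
  shows "Const a * Var S + Const b * Var T \<noteq> 0"
proof
  assume eq: "Const a * Var S + Const b * Var T = 0"
  have "a * x + b * y = 0" for x y
    using arg_cong[OF eq, of "eval_pol (\<lambda>z. if z = S then x else y)"] by (simp add: eval_pol_simps)
  from this[of 1 0] this[of 0 1] show False
    using assms by simp
qed

text \<open>It makes the ideal depend on the space alone, so that the given family may be replaced
  by the basis of a normal form.\<close>

lemma ideal_span_kspan: "ideal.span (kspace.span X) = ideal.span X"
proof -
  have "kspace.subspace (ideal.span X)"
    by (auto simp: kspace.subspace_def kscale_def ideal.span_zero intro: ideal.span_add ideal.span_scale)
  then have "kspace.span X \<subseteq> ideal.span X"
    by (intro kspace.span_minimal ideal.span_superset)
  then show ?thesis
    unfolding ideal.span_eq using kspace.span_superset ideal.span_superset by blast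
qed

lemma inj_uv_pol: "inj (uv_pol :: 'k::field poly poly \<Rightarrow> 'k pol)"
proof (rule injI)
  fix x y :: "'k poly poly"
  assume eq: "uv_pol x = uv_pol y"
  let ?\<Theta> = "pol_of_bipoly (Const 1 * Var S + Const 0 * Var T) (Const 0 * Var S + Const (1 :: 'k) * Var T)"
  have "inj ?\<Theta>"
    by (rule bij_is_inj, rule bij_pol_of_bipoly[of 1 1 0 0]) simp_all
  moreover have "?\<Theta> (bimonom 0 0 x) = ?\<Theta> (bimonom 0 0 y)"
    by (simp add: pol_of_bipoly_bimonom eq)
  ultimately have "bimonom 0 0 x = bimonom 0 0 y"
    by (rule injD)
  then show "x = y"
    by (metis bicoeff_bimonom)
qed

section \<open>The primes \<open>\<langle>s, t, L\<rangle>\<close>\<close>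

text \<open>The invertible change of variables makes \<open>s', t'\<close> and \<open>s, t\<close>
  generate the same ideal, so the resulting primes do not depend on the chosen coordinates.\<close>

lemma st_prime_image:
  assumes D: "a * d - b * c \<noteq> 0"
    and s': "s' = Const a * Var S + Const b * Var T" and t': "t' = Const c * Var S + Const d * Var T"
  shows "pol_of_bipoly s' t' ` {g. linform x y dvd bicoeff g 0 0} = st_prime (uv_form x y)"
proof -
  let ?\<Theta> = "pol_of_bipoly s' t'"
  have surj: "surj ?\<Theta>"
    using bij_pol_of_bipoly[OF assms] by (rule bij_is_surj)
  have "?\<Theta> ` {g. linform x y dvd bicoeff g 0 0} =
      ideal.span (?\<Theta> ` {bimonom 1 0 1, bimonom 0 1 1, bimonom 0 0 (linform x y)})"
    by (simp only: ideal_span_bimonom ideal_span_image[OF unital_hom_pol_of_bipoly surj])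
  also have "?\<Theta> ` {bimonom 1 0 1, bimonom 0 1 1, bimonom 0 0 (linform x y)} = {s', t', uv_form x y}"
    by (simp add: pol_of_bipoly_bimonom unital_homD[OF unital_hom_uv_pol] uv_pol_linform)
  also have "ideal.span {s', t', uv_form x y} = ideal.span {Var S, Var T, uv_form x y}"
  proof -
    define E where "E = a * d - b * c"
    have E: "Const (inverse E) * Const E = 1"
      using D unfolding E_def Const_simps(3)[symmetric] by (simp add: Const_simps)
    have "Const E * Var S = Const d * s' - Const b * t'" "Const E * Var T = Const a * t' - Const c * s'"
      unfolding E_def s' t' Const_simps(3,6) by (simp_all only: algebra_simps)
    moreover have inv: "x = Const (inverse E) * (Const E * x)" for x
      using E by (simp flip: mult.assoc)
    ultimately have "Var S = Const (inverse E) * (Const d * s' - Const b * t')"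
      "Var T = Const (inverse E) * (Const a * t' - Const c * s')"
      using inv[of "Var S"] inv[of "Var T"] by simp_all
    moreover have "Const (inverse E) * (Const d * s' - Const b * t') \<in> ideal.span {s', t', uv_form x y}"
      "Const (inverse E) * (Const a * t' - Const c * s') \<in> ideal.span {s', t', uv_form x y}"
      by (intro ideal.span_diff ideal.span_scale ideal.span_base; simp)+
    moreover have "s' \<in> ideal.span {Var S, Var T, uv_form x y}" "t' \<in> ideal.span {Var S, Var T, uv_form x y}"
      unfolding s' t' by (intro ideal.span_add ideal.span_scale ideal.span_base; simp)+
    ultimately show ?thesis
      unfolding ideal.span_eq by (auto intro: ideal.span_base)
  qed
  finally show ?thesis
    by (simp add: st_prime_def)
qed

text \<open>Equality of the ideals, read in iterated polynomials, makes one linear form divide the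
  other, and then the coefficient pairs are proportional.\<close>

lemma st_prime_eq_iff:
  assumes "L1 \<in> bigraded 0 1" "L2 \<in> bigraded 0 1" "L1 \<noteq> 0" "L2 \<noteq> (0 :: 'k::field pol)"
  shows "st_prime L1 = st_prime L2 \<longleftrightarrow> associated_up_to_scalar L1 L2"
proof
  obtain x y z w where L: "L1 = uv_form x y" "L2 = uv_form z w"
    using assms by (metis bigraded_0_1_iff)
  have nz: "(x, y) \<noteq> (0, 0)" "(z, w) \<noteq> (0, 0)"
    using assms by (auto simp: L uv_form_0)
  let ?\<Theta> = "pol_of_bipoly (Const 1 * Var S + Const 0 * Var T) (Const 0 * Var S + Const (1 :: 'k) * Var T)"
  have bij: "bij ?\<Theta>"
    by (rule bij_pol_of_bipoly[of 1 1 0 0]) simp_all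
  have im: "?\<Theta> ` {g. linform i j dvd bicoeff g 0 0} = st_prime (uv_form i j)" for i j
    by (rule st_prime_image[of 1 1 0 0]) simp_all
  assume "st_prime L1 = st_prime L2"
  then have "{g. linform x y dvd bicoeff g 0 0} = {g. linform z w dvd bicoeff g 0 0}"
    using bij unfolding L im[symmetric] by (simp add: bij_def inj_image_eq_iff)
  moreover have "bimonom 0 0 (linform z w) \<in> {g. linform z w dvd bicoeff g 0 0}"
    by (simp add: bicoeff_bimonom)
  ultimately have "linform x y dvd linform z w"
    by (metis (mono_tags, lifting) bicoeff_bimonom mem_Collect_eq)
  then obtain c where "c \<noteq> 0" "x = c * z" "y = c * w"
    using proportional_pairs[OF linform_dvd_linform nz] by blast
  then show "associated_up_to_scalar L1 L2"
    unfolding associated_up_to_scalar_def L kscale_def uv_form_scale by blast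
next
  assume "associated_up_to_scalar L1 L2"
  then obtain c where c: "c \<noteq> 0" "L1 = Const c * L2"
    by (auto simp: associated_up_to_scalar_def kscale_def)
  then have "L2 = Const (inverse c) * L1"
    by (simp add: Const_simps flip: mult.assoc Const_simps(3))
  then have "L1 \<in> st_prime L2" "L2 \<in> st_prime L1"
    unfolding st_prime_def using c(2) by (metis ideal.span_base ideal.span_scale insertCI)+
  then show "st_prime L1 = st_prime L2"
    unfolding st_prime_def ideal.span_eq by (auto intro: ideal.span_base)
qed

section \<open>Surfaces with a linear syzygy\<close>

locale linear_syzygy_surface =
  fixes p :: "nat \<Rightarrow> 'k::alg_closed_field pol" and W I :: "'k pol set"
  assumes W_def: "W = kspace.span (p ` {..<4})"
    and W_bidegree: "W \<subseteq> bigraded 2 1"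
    and W_dim: "kspace.dim W = 4"
    and I_def: "I = ideal.span (p ` {..<4})"
    and bpf: "basepoint_free p"
    and syz: "unique_first_syzygy p 0 1"
begin

lemma subspace_W: "kspace.subspace W"
  by (simp add: W_def)

lemma in_W_iff: "x \<in> W \<longleftrightarrow> (\<exists>a. x = (\<Sum>i<4. kscale (a i) (p i)))"
proof
  have "\<exists>a. x = (\<Sum>i<4. kscale (a i) (p i))" if "x \<in> kspace.span (p ` {..<4})"
    using that
  proof (induction rule: kspace.span_induct_alt)
    case base
    show ?case by (rule exI[of _ "\<lambda>_. 0"]) simp
  next
    case (step c x y)
    then obtain a j where a: "y = (\<Sum>i<4. kscale (a i) (p i))" and j: "j < 4" "x = p j"
      by auto
    have "(\<Sum>i<4. kscale (if i = j then c else 0) (p i)) = kscale c x"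
      using j by (simp add: if_distrib[of "\<lambda>c. kscale c _"] cong: if_cong)
    then have "kscale c x + y = (\<Sum>i<4. kscale ((if i = j then c else 0) + a i) (p i))"
      by (simp only: a kspace.scale_left_distrib sum.distrib)
    then show ?case by (rule exI[of _ "\<lambda>i. (if i = j then c else 0) + a i"])
  qed
  then show "\<exists>a. x = (\<Sum>i<4. kscale (a i) (p i))" if "x \<in> W"
    using that by (simp add: W_def)
qed (auto simp: W_def intro!: kspace.span_sum kspace.span_scale intro: kspace.span_base)

text \<open>Converse to the extraction of \<open>h\<close> from a syzygy: if \<open>h u\<close> and
  \<open>h v\<close> have coordinates \<open>x i\<close> and \<open>y i\<close>, then
  \<open>y i u - x i v\<close> is a syzygy. Uniqueness makes the \<open>y i\<close> of both forms
  proportional, hence \<open>h v\<close> and \<open>h' v\<close>.\<close>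

lemma quadratic_unique:
  assumes "h * Var U \<in> W" "h * Var V \<in> W" "h' * Var U \<in> W" "h' * Var V \<in> W" "h \<noteq> 0" "h' \<noteq> 0"
  obtains c where "h' = Const c * h"
proof -
  have syzygy: "first_syzygy p 0 1 (\<lambda>i. uv_form (y i) (- x i))"
    if "h * Var U = (\<Sum>i<4. kscale (x i) (p i))" "h * Var V = (\<Sum>i<4. kscale (y i) (p i))" "h \<noteq> 0" for h x y
    unfolding first_syzygy_def
  proof (intro conjI)
    have "(\<Sum>i<4. uv_form (y i) (- x i) * p i) =
        Var U * (\<Sum>i<4. kscale (y i) (p i)) - Var V * (\<Sum>i<4. kscale (x i) (p i))"
      by (simp add: uv_form_def kscale_def Const_simps sum_distrib_left sum_subtractf[symmetric] algebra_simps)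
    then show "(\<Sum>i<4. uv_form (y i) (- x i) * p i) = 0"
      by (simp add: that(1,2)[symmetric] mult_ac)
    show "\<exists>i<4. uv_form (y i) (- x i) \<noteq> 0"
    proof (rule ccontr)
      assume "\<not> ?thesis"
      then have "h * Var V = 0"
        by (simp add: that(2) uv_form_eq_0_iff)
      then show False
        using that(3) by (simp add: pol_mult_eq_0_iff Var_neq_0)
    qed
  qed (simp add: uv_form_bigraded del: One_nat_def)
  obtain x y where xy: "h * Var U = (\<Sum>i<4. kscale (x i) (p i))" "h * Var V = (\<Sum>i<4. kscale (y i) (p i))"
    using assms(1,2) by (auto simp: in_W_iff)
  obtain x' y' where xy': "h' * Var U = (\<Sum>i<4. kscale (x' i) (p i))" "h' * Var V = (\<Sum>i<4. kscale (y' i) (p i))"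
    using assms(3,4) by (auto simp: in_W_iff)
  from syz obtain g where g: "\<And>g'. first_syzygy p 0 1 g' \<Longrightarrow> (\<exists>c. c \<noteq> 0 \<and> (\<forall>i<4. g' i = kscale c (g i)))"
    unfolding unique_first_syzygy_def by blast
  from g[OF syzygy[OF xy assms(5)]] obtain c where
    c: "c \<noteq> 0" "\<And>i. i < 4 \<Longrightarrow> uv_form (y i) (- x i) = kscale c (g i)" by blast
  from g[OF syzygy[OF xy' assms(6)]] obtain c' where
    c': "c' \<noteq> 0" "\<And>i. i < 4 \<Longrightarrow> uv_form (y' i) (- x' i) = kscale c' (g i)" by blast
  have "y' i = c' / c * y i" if "i < 4" for i
  proof -
    have "uv_form (y' i) (- x' i) = kscale (c' / c) (uv_form (y i) (- x i))"
      using c c' that by simp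
    also have "\<dots> = uv_form (c' / c * y i) (c' / c * - x i)"
      unfolding kscale_def by (rule uv_form_scale)
    finally show ?thesis
      by (simp only: uv_form_eq_iff)
  qed
  then have "h' * Var V = (\<Sum>i<4. kscale (c' / c) (kscale (y i) (p i)))"
    unfolding xy'(2) by (intro sum.cong) auto
  also have "\<dots> = kscale (c' / c) (h * Var V)"
    unfolding xy(2) by (rule kspace.scale_sum_right[symmetric])
  finally have "Var V * h' = Var V * (Const (c' / c) * h)"
    by (simp add: kscale_def mult_ac)
  then show thesis
    using that unfolding pol_mult_cancel_left by (auto simp: Var_neq_0)
qed

text \<open>Vanishing at a point is a linear condition, so every set spanning \<open>W\<close>
  inherits basepoint freeness.\<close>

lemma eval_nonzero:
  assumes "(\<sigma> S, \<sigma> T) \<noteq> (0, 0)" "(\<sigma> U, \<sigma> V) \<noteq> (0, 0)" and B: "W \<subseteq> kspace.span B"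
  shows "\<exists>x\<in>B. eval_pol \<sigma> x \<noteq> 0"
proof (rule ccontr)
  assume "\<not> ?thesis"
  then have "B \<subseteq> {x. eval_pol \<sigma> x = 0}" by auto
  moreover have "kspace.subspace {x. eval_pol \<sigma> x = 0}"
    by (auto simp: kspace.subspace_def eval_pol_simps)
  ultimately have "W \<subseteq> {x. eval_pol \<sigma> x = 0}"
    using B kspace.span_minimal by blast
  moreover have "p i \<in> W" if "i < 4" for i
    using that by (auto simp: W_def intro: kspace.span_base)
  ultimately show False
    using bpf assms(1,2) unfolding basepoint_free_def by blast
qed


text \<open>The two alternatives are a double root and two distinct roots of \<open>h\<close>, and
  they lead to the two normal forms.\<close>

lemma obtain_quadratic:
  obtains h a b c d where "a * d - b * c \<noteq> 0" "h * Var U \<in> W" "h * Var V \<in> W"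
    "h = (Const a * Var S + Const b * Var T)\<^sup>2 \<or>
     h = (Const a * Var S + Const b * Var T) * (Const c * Var S + Const d * Var T)"
proof -
  obtain g where "first_syzygy p 0 1 g"
    using syz by (auto simp: unique_first_syzygy_def)
  then obtain \<alpha> \<beta> \<gamma> where nz: "(\<alpha>, \<beta>, \<gamma>) \<noteq> (0, 0, 0)"
    and in_W: "st_quadratic (Var S) (Var T) \<alpha> \<beta> \<gamma> * Var U \<in> W" "st_quadratic (Var S) (Var T) \<alpha> \<beta> \<gamma> * Var V \<in> W"
    using syzygy_quadratic[OF W_def W_bidegree W_dim] by metis
  obtain a b c d where f: "\<alpha> = a * c" "\<beta> = a * d + b * c" "\<gamma> = b * d"
    by (rule binary_quadratic_factorization)
  have st: "st_quadratic (Var S) (Var T) \<alpha> \<beta> \<gamma> =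
      (Const a * Var S + Const b * Var T) * (Const c * Var S + Const d * Var T)"
    unfolding st_quadratic_def f Const_simps(2,3) by (simp only: power2_eq_square algebra_simps)
  show thesis
  proof (cases "a * d - b * c = 0")
    case False
    then show thesis
      using that in_W unfolding st by blast
  next
    case True
    have "(a, b) \<noteq> (0, 0)" "(c, d) \<noteq> (0, 0)"
      using nz by (auto simp: f)
    then obtain k where k: "k \<noteq> 0" "c = k * a" "d = k * b"
      using proportional_pairs[of c b d a] True by (auto simp: mult.commute)
    define s where "s = Const a * Var S + Const b * Var T"
    \<comment> \<open>With proportional factors the form is \<open>k s^2\<close>; the scalar is
      divided out inside \<open>W\<close>. Any second linear form independent of \<open>s\<close>
      then completes the change of variables.\<close>
    have "kscale (inverse k) (st_quadratic (Var S) (Var T) \<alpha> \<beta> \<gamma> * Var x) = s\<^sup>2 * Var x" for x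
    proof -
      have "Const (inverse k) * Const k = 1"
        using k(1) by (simp add: Const_simps flip: Const_simps(3))
      moreover have "kscale (inverse k) (st_quadratic (Var S) (Var T) \<alpha> \<beta> \<gamma> * Var x) =
          (Const (inverse k) * Const k) * (s\<^sup>2 * Var x)"
        unfolding st k kscale_def s_def Const_simps(3) by (simp only: power2_eq_square algebra_simps)
      ultimately show ?thesis by simp
    qed
    then have "s\<^sup>2 * Var U \<in> W" "s\<^sup>2 * Var V \<in> W"
      using kspace.subspace_scale[OF subspace_W] in_W by metis+
    moreover obtain c' d' where "a * d' - b * c' \<noteq> 0"
    proof (cases "a = 0")
      case True
      then show thesis
        using that[of 0 1] \<open>(a, b) \<noteq> (0, 0)\<close> by simp
    next
      case False
      then show thesis
        using that[of 1 0] by simp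
    qed
    ultimately show thesis
      using that s_def by blast
  qed
qed

lemma independent_pair:
  fixes h :: "'k pol"
  assumes "h \<noteq> 0"
  shows "h * Var U \<notin> kspace.span {h * Var V}" "kspace.independent {h * Var U, h * Var V}"
    "h * Var U \<noteq> h * Var V"
proof -
  have eq: "Var U = (Const c * Var V :: 'k pol) \<Longrightarrow> False" for c
    unfolding Var_eq_uv_form uv_form_scale uv_form_eq_iff by simp
  show notin: "h * Var U \<notin> kspace.span {h * Var V}"
  proof
    assume "h * Var U \<in> kspace.span {h * Var V}"
    then obtain c where "h * Var U = h * (Const c * Var V)"
      by (auto simp: kspace.span_singleton kscale_def mult_ac)
    then show False
      using assms by (auto simp: pol_mult_cancel_left dest: eq)
  qed
  have "h * Var V \<noteq> 0"
    using assms by (simp add: pol_mult_eq_0_iff Var_neq_0)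
  then show "kspace.independent {h * Var U, h * Var V}"
    using notin by (intro kspace.independent_insertI) (auto simp: kspace.dependent_single kspace.independent_empty)
  show "h * Var U \<noteq> h * Var V"
    using notin kspace.span_base[of "h * Var V" "{h * Var V}"] by auto
qed

text \<open>Exchange: any two vectors extending \<open>hu, hv\<close> to a basis may be reduced modulo \<open>hu, hv\<close>.\<close>

lemma extend_basis:
  assumes hW: "h * Var U \<in> W" "h * Var V \<in> W" "h \<noteq> 0"
    and expand: "\<And>q. q \<in> bigraded 2 1 \<Longrightarrow> \<exists>x x' y y' z z'.
      q = h * uv_form x x' + e1 * uv_form y y' + e2 * uv_form z z'"
  obtains a1 b1 a2 b2 a3 b3 a4 b4 B where
    "B = [h * Var U, h * Var V, e1 * uv_form a1 b1 + e2 * uv_form a2 b2, e1 * uv_form a3 b3 + e2 * uv_form a4 b4]"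
    "distinct B" "kspace.independent (set B)" "kspace.span (set B) = W"
proof -
  let ?P = "{h * Var U, h * Var V}"
  have uv: "h * uv_form x y \<in> kspace.span ?P" for x y
  proof -
    have "h * uv_form x y = kscale x (h * Var U) + kscale y (h * Var V)"
      by (simp add: uv_form_def kscale_def algebra_simps)
    also have "\<dots> \<in> kspace.span ?P"
      by (intro kspace.span_add kspace.span_scale kspace.span_base) auto
    finally show ?thesis .
  qed
  \<comment> \<open>While \<open>C\<close> has fewer than four elements, some \<open>q\<close> in
    \<open>W\<close> lies outside its span. Its \<open>h\<close>-part lies in the span of
    \<open>hu, hv\<close>, so removing it keeps \<open>q\<close> in \<open>W\<close> and outside the
    span of \<open>C\<close>.\<close>
  have new: "\<exists>a b a' b'. e1 * uv_form a b + e2 * uv_form a' b' \<in> W \<and> e1 * uv_form a b + e2 * uv_form a' b' \<notin> kspace.span C"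
    if "?P \<subseteq> C" "C \<subseteq> W" "kspace.independent C" "card C < 4" for C
  proof -
    have "\<not> W \<subseteq> kspace.span C"
      using kspace.basis_card_eq_dim[OF that(2) _ that(3)] that(4) W_dim by auto
    then obtain q where q: "q \<in> W" "q \<notin> kspace.span C" by blast
    then obtain x x' y y' z z' where e: "q = h * uv_form x x' + e1 * uv_form y y' + e2 * uv_form z z'"
      using expand W_bidegree by (meson subsetD)
    have hC: "h * uv_form x x' \<in> kspace.span C"
      using uv kspace.span_mono[OF that(1)] by blast
    have "e1 * uv_form y y' + e2 * uv_form z z' = q - h * uv_form x x'"
      by (simp add: e)
    moreover have "q - h * uv_form x x' \<in> W"
      using q(1) uv hW kspace.span_minimal[OF _ subspace_W, of ?P]
      by (intro kspace.subspace_diff[OF subspace_W]) auto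
    moreover have "q - h * uv_form x x' \<notin> kspace.span C"
      using q(2) hC kspace.span_add by force
    ultimately show ?thesis by metis
  qed
  have P: "kspace.independent ?P" "card ?P = 2" "?P \<subseteq> W"
    using independent_pair[OF hW(3)] hW by auto
  obtain a1 b1 a2 b2 where f: "e1 * uv_form a1 b1 + e2 * uv_form a2 b2 \<in> W"
      "e1 * uv_form a1 b1 + e2 * uv_form a2 b2 \<notin> kspace.span ?P" (is "?f \<notin> _")
    using new[OF order_refl P(3,1)] P(2) by auto
  have "?f \<notin> ?P"
    using f(2) kspace.span_base by metis
  moreover have "insert ?f ?P \<subseteq> W"
    using f(1) P(3) by simp
  ultimately have F: "kspace.independent (insert ?f ?P)" "insert ?f ?P \<subseteq> W" "?f \<notin> ?P"
    using kspace.independent_insertI[OF f(2) P(1)] by simp_all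
  then have F3: "card (insert ?f ?P) = 3"
    using P(2) by simp
  obtain a3 b3 a4 b4 where g: "e1 * uv_form a3 b3 + e2 * uv_form a4 b4 \<in> W"
      "e1 * uv_form a3 b3 + e2 * uv_form a4 b4 \<notin> kspace.span (insert ?f ?P)" (is "?g \<notin> _")
    using new[OF _ F(2,1)] F3 by auto
  have "?g \<notin> insert ?f ?P"
    using g(2) kspace.span_base by metis
  moreover have "insert ?g (insert ?f ?P) \<subseteq> W"
    using g(1) F(2) by simp
  ultimately have G: "kspace.independent (insert ?g (insert ?f ?P))" "insert ?g (insert ?f ?P) \<subseteq> W" "?g \<notin> insert ?f ?P"
    using kspace.independent_insertI[OF g(2) F(1)] by simp_all
  then have G4: "card (insert ?g (insert ?f ?P)) = 4"
    using F3 by simp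
  \<comment> \<open>A further independent vector would give five independent vectors in a space
    spanned by four.\<close>
  have "W \<subseteq> kspace.span (insert ?g (insert ?f ?P))"
  proof
    fix w assume w: "w \<in> W"
    show "w \<in> kspace.span (insert ?g (insert ?f ?P))"
    proof (rule ccontr)
      assume notin: "\<not> ?thesis"
      then have "kspace.independent (insert w (insert ?g (insert ?f ?P)))"
        using G(1) by (rule kspace.independent_insertI)
      moreover have "insert w (insert ?g (insert ?f ?P)) \<subseteq> kspace.span (p ` {..<4})"
        using w G(2) W_def by auto
      ultimately have "card (insert w (insert ?g (insert ?f ?P))) \<le> card (p ` {..<4})"
        using kspace.independent_span_bound[of "p ` {..<4}"] by blast
      also have "\<dots> \<le> 4"
        using card_image_le[of "{..<4}" p] by simp
      finally have "card (insert w (insert ?g (insert ?f ?P))) \<le> 4" .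
      moreover have "w \<notin> insert ?g (insert ?f ?P)"
        using notin kspace.span_base by metis
      then have "card (insert w (insert ?g (insert ?f ?P))) = Suc (card (insert ?g (insert ?f ?P)))"
        by (intro card_insert_disjoint) simp_all
      ultimately show False
        unfolding G4 by simp
    qed
  qed
  then have span: "kspace.span (insert ?g (insert ?f ?P)) = W"
    using kspace.span_minimal[OF G(2) subspace_W] by blast
  have set: "set [h * Var U, h * Var V, ?f, ?g] = insert ?g (insert ?f ?P)"
    by auto
  show thesis
  proof (rule that[OF refl])
    show "distinct [h * Var U, h * Var V, ?f, ?g]"
      using F(3) G(3) independent_pair(3)[OF hW(3)] by auto
    show "kspace.independent (set [h * Var U, h * Var V, ?f, ?g])"
      unfolding set by (fact G(1))
    show "kspace.span (set [h * Var U, h * Var V, ?f, ?g]) = W"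
      unfolding set by (fact span)
  qed
qed

lemma exists_normal_form: "\<exists>A. normal_form_matrix W A"
proof -
  obtain h a b c d where D: "a * d - b * c \<noteq> 0" and hW: "h * Var U \<in> W" "h * Var V \<in> W" and
    h: "h = (Const a * Var S + Const b * Var T)\<^sup>2 \<or>
     h = (Const a * Var S + Const b * Var T) * (Const c * Var S + Const d * Var T)"
    by (rule obtain_quadratic)
  define s' t' where "s' = Const a * Var S + Const b * Var T" and "t' = Const c * Var S + Const d * Var T"
  note st = this
  have nz: "s' \<noteq> 0" "t' \<noteq> 0"
    using D unfolding st by (auto intro!: st_form_neq_0)
  note new = bigraded_2_1_new_variables[OF D st]
  let ?A = "\<lambda>a1 b1 a2 b2 a3 b3 a4 b4.
    vector [vector [uv_form a1 b1, uv_form a2 b2], vector [uv_form a3 b3, uv_form a4 b4]] :: 'k pol ^ 2 ^ 2"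
  have bi: "\<forall>i j. ?A a1 b1 a2 b2 a3 b3 a4 b4 $ i $ j \<in> bigraded 0 1" for a1 b1 a2 b2 a3 b3 a4 b4
    by (simp add: forall_2 uv_form_bigraded del: One_nat_def)
  have st_kscale: "s' = kscale a (Var S) + kscale b (Var T)" "t' = kscale c (Var S) + kscale d (Var T)"
    by (simp_all add: st kscale_def)
  from h consider "h = s'\<^sup>2" | "h = s' * t'"
    unfolding st by blast
  then show ?thesis
  proof cases
    case 1
    have expand: "\<exists>x x' y y' z z'. q = h * uv_form x x' + s' * t' * uv_form y y' + t'\<^sup>2 * uv_form z z'"
      if "q \<in> bigraded 2 1" for q
      using new[OF that] unfolding 1 by metis
    have "h \<noteq> 0"
      using nz by (simp add: 1 power2_eq_square pol_mult_eq_0_iff)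
    then obtain a1 b1 a2 b2 a3 b3 a4 b4 B where "B = [h * Var U, h * Var V, s' * t' * uv_form a1 b1 + t'\<^sup>2 * uv_form a2 b2,
        s' * t' * uv_form a3 b3 + t'\<^sup>2 * uv_form a4 b4]"
      "distinct B" "kspace.independent (set B)" "kspace.span (set B) = W"
      using extend_basis[OF hW _ expand] by metis
    then have "normal_form_matrix W (?A a1 b1 a2 b2 a3 b3 a4 b4)"
      unfolding normal_form_matrix_def 1
      by (intro conjI bi exI[of _ a] exI[of _ b] exI[of _ c] exI[of _ d] exI[of _ s'] exI[of _ t'] exI[of _ B] D st_kscale)
         simp_all
    then show ?thesis by blast
  next
    case 2
    have expand: "\<exists>x x' y y' z z'. q = h * uv_form x x' + s'\<^sup>2 * uv_form y y' + t'\<^sup>2 * uv_form z z'"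
      if "q \<in> bigraded 2 1" for q
      using new[OF that] unfolding 2 by (metis add.commute add.left_commute)
    have "h \<noteq> 0"
      using nz by (simp add: 2 pol_mult_eq_0_iff)
    then obtain a1 b1 a2 b2 a3 b3 a4 b4 B where "B = [h * Var U, h * Var V, s'\<^sup>2 * uv_form a1 b1 + t'\<^sup>2 * uv_form a2 b2,
        s'\<^sup>2 * uv_form a3 b3 + t'\<^sup>2 * uv_form a4 b4]"
      "distinct B" "kspace.independent (set B)" "kspace.span (set B) = W"
      using extend_basis[OF hW _ expand] by metis
    then have "normal_form_matrix W (?A a1 b1 a2 b2 a3 b3 a4 b4)"
      unfolding normal_form_matrix_def 2
      by (intro conjI bi exI[of _ a] exI[of _ b] exI[of _ c] exI[of _ d] exI[of _ s'] exI[of _ t'] exI[of _ B] D st_kscale)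
         simp_all
    then show ?thesis by blast
  qed
qed

end


section \<open>The determinant and the embedded primes of a normal form\<close>

context linear_syzygy_surface
begin

text \<open>A common zero of two linear forms in \<open>u, v\<close>, together with a zero of the quadratic forms
  multiplying the other generators, would be a base point.\<close>

lemma forms_independent:
  assumes B: "W \<subseteq> kspace.span {h * Var U, h * Var V, e * f + e' * uv_form a b, e * g + e' * uv_form c d}"
    and \<sigma>: "(s, t) \<noteq> (0, 0)" "\<And>\<sigma>. \<sigma> S = s \<Longrightarrow> \<sigma> T = t \<Longrightarrow> eval_pol \<sigma> h = 0 \<and> eval_pol \<sigma> e = 0"
  shows "a * d - b * c \<noteq> 0"
proof
  assume 0: "a * d - b * c = 0"
  have "\<exists>u v. (u, v) \<noteq> (0, 0) \<and> a * u + b * v = 0 \<and> c * u + d * v = 0"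
  proof (cases "(a, b) = (0, 0)")
    case False
    then show ?thesis
      using 0 by (intro exI[of _ b] exI[of _ "- a"]) (auto simp: algebra_simps)
  next
    case True
    show ?thesis
    proof (cases "(c, d) = (0, 0)")
      case False
      then show ?thesis
        using True by (intro exI[of _ d] exI[of _ "- c"]) (auto simp: algebra_simps)
    next
      case *: True
      with True show ?thesis
        by (intro exI[of _ 1] exI[of _ 1]) simp
    qed
  qed
  then obtain u v where uv: "(u, v) \<noteq> (0, 0)" "a * u + b * v = 0" "c * u + d * v = 0"
    by blast
  define \<sigma> where "\<sigma> x = (case x of S \<Rightarrow> s | T \<Rightarrow> t | U \<Rightarrow> u | V \<Rightarrow> v)" for x
  have "\<exists>x\<in>{h * Var U, h * Var V, e * f + e' * uv_form a b, e * g + e' * uv_form c d}. eval_pol \<sigma> x \<noteq> 0"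
    using \<sigma>(1) uv(1) by (intro eval_nonzero B) (simp_all add: \<sigma>_def)
  moreover have "eval_pol \<sigma> h = 0" "eval_pol \<sigma> e = 0"
    using \<sigma>(2)[of \<sigma>] by (simp_all add: \<sigma>_def)
  ultimately show False
    using uv(2,3) by (simp add: eval_pol_simps \<sigma>_def)
qed

text \<open>If the determinant vanished, the two rows would be proportional, and the quadratic form
  \<open>\<kappa> e + e'\<close> would give a second syzygy.\<close>

lemma forms_det_nonzero:
  assumes W: "W = kspace.span {h * Var U, h * Var V,
      e * uv_form a1 b1 + e' * uv_form a2 b2, e * uv_form a3 b3 + e' * uv_form a4 b4}"
    and indep: "a2 * b4 - b2 * a4 \<noteq> 0" and "h \<noteq> 0"
    and \<sigma>: "eval_pol \<sigma> h = 0" "eval_pol \<sigma> e = 0" "eval_pol \<sigma> e' = 1"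
  shows "uv_form a1 b1 * uv_form a4 b4 - uv_form a2 b2 * uv_form a3 b3 \<noteq> 0"
proof
  assume "uv_form a1 b1 * uv_form a4 b4 - uv_form a2 b2 * uv_form a3 b3 = 0"
  then have "uv_pol (linform a1 b1 * linform a4 b4) = uv_pol (linform a2 b2 * linform a3 b3)"
    by (simp add: unital_homD[OF unital_hom_uv_pol] uv_pol_linform)
  then have eq: "linform a1 b1 * linform a4 b4 = linform a2 b2 * linform a3 b3"
    by (rule injD[OF inj_uv_pol])
  have nz: "(a2, b2) \<noteq> (0, 0)"
    using indep by auto
  have "\<not> linform a2 b2 dvd linform a4 b4"
    using linform_dvd_linform[of a2 b2 a4 b4] indep by auto
  moreover have "linform a2 b2 dvd linform a1 b1 * linform a4 b4"
    by (simp add: eq)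
  ultimately have "linform a2 b2 dvd linform a1 b1"
    using prime_elem_dvd_multD[OF prime_elem_linform[OF nz]] by blast
  then have ab: "a2 * b1 = b2 * a1"
    by (rule linform_dvd_linform)
  \<comment> \<open>The prime \<open>l2\<close> divides \<open>l1 l4 = l2 l3\<close> but not
    \<open>l4\<close>, hence it divides \<open>l1\<close>. So the first column is \<open>k\<close>
    times the second, and the last two generators are \<open>h' l2\<close> and \<open>h' l4\<close>
    with \<open>h' = k e + e'\<close>.\<close>
  obtain k where k: "a1 = k * a2" "b1 = k * b2"
  proof (cases "(a1, b1) = (0, 0)")
    case True
    then show thesis using that[of 0] by simp
  next
    case False
    then show thesis
      using that proportional_pairs[of a1 b2 b1 a2] ab nz by (metis mult.commute)
  qed
  have "linform a2 b2 * ([:[:k:]:] * linform a4 b4) = linform a2 b2 * linform a3 b3"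
    unfolding eq[symmetric] k linform_scale[symmetric] by (simp only: mult_ac)
  moreover have "linform a2 b2 \<noteq> 0"
    using nz by (auto simp: linform_eq_0_iff)
  ultimately have "linform (k * a4) (k * b4) = linform a3 b3"
    unfolding linform_scale by simp
  then have k': "a3 = k * a4" "b3 = k * b4"
    by (simp_all only: linform_eq_iff)
  define h' where "h' = Const k * e + e'"
  have f: "h' * uv_form a2 b2 \<in> W" "h' * uv_form a4 b4 \<in> W"
  proof -
    have "h' * uv_form a2 b2 = e * uv_form a1 b1 + e' * uv_form a2 b2"
      "h' * uv_form a4 b4 = e * uv_form a3 b3 + e' * uv_form a4 b4"
      unfolding h'_def k k' uv_form_scale[symmetric] by (simp_all only: algebra_simps)
    then show "h' * uv_form a2 b2 \<in> W" "h' * uv_form a4 b4 \<in> W"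
      unfolding W by (simp_all add: kspace.span_base)
  qed
  define D where "D = a2 * b4 - b2 * a4"
  have "kscale x (h' * uv_form a2 b2) + kscale y (h' * uv_form a4 b4) \<in> W" for x y
    by (intro kspace.subspace_add[OF subspace_W] kspace.subspace_scale[OF subspace_W] f)
  moreover have "kscale x (h' * uv_form a2 b2) + kscale y (h' * uv_form a4 b4) =
      h' * uv_form (x * a2 + y * a4) (x * b2 + y * b4)" for x y
    unfolding kscale_def uv_form_add[symmetric] uv_form_scale[symmetric] by (simp only: algebra_simps)
  ultimately have comb: "h' * uv_form (x * a2 + y * a4) (x * b2 + y * b4) \<in> W" for x y
    by metis
  \<comment> \<open>The coefficients form the inverse of the matrix of \<open>l2, l4\<close>; the
    combinations of \<open>h' l2\<close> and \<open>h' l4\<close> become \<open>h' u\<close> and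
    \<open>h' v\<close>.\<close>
  have "b4 / D * a2 + - b2 / D * a4 = 1" "b4 / D * b2 + - b2 / D * b4 = 0"
    "- a4 / D * a2 + a2 / D * a4 = 0" "- a4 / D * b2 + a2 / D * b4 = 1"
    using indep by (simp_all add: D_def divide_simps)
  with comb[of "b4 / D" "- b2 / D"] comb[of "- a4 / D" "a2 / D"]
  have "h' * Var U \<in> W" "h' * Var V \<in> W"
    by (simp_all only: Var_eq_uv_form)
  moreover have "h * Var U \<in> W" "h * Var V \<in> W"
    unfolding W by (simp_all add: kspace.span_base)
  \<comment> \<open>At \<open>\<sigma>\<close> the form \<open>h\<close> vanishes while
    \<open>h'\<close> does not, so \<open>h'\<close> cannot be a multiple of
    \<open>h\<close>.\<close>
  moreover have "eval_pol \<sigma> h' = 1"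
    using \<sigma> by (simp add: h'_def eval_pol_simps)
  moreover from this have "h' \<noteq> 0"
    by (auto simp: eval_pol_simps)
  ultimately obtain c where "h' = Const c * h"
    using \<open>h \<noteq> 0\<close> quadratic_unique by metis
  with \<open>eval_pol \<sigma> h' = 1\<close> show False
    using \<sigma> by (simp add: eval_pol_simps)
qed

text \<open>Evaluation on the lines \<open>s' = 0\<close> and, in the second form,
  \<open>t' = 0\<close> gives independent columns; with the uniqueness of the syzygy the determinant
  is nonzero. This makes the factors \<open>L1\<close>, \<open>L2\<close> prime elements, as the
  locale \<open>form_ideal\<close> demands, and its result is carried over by the
  isomorphism.\<close>

lemma normal_form_embedded:
  assumes "normal_form_matrix W A"
  shows "det A \<noteq> 0"
    and "\<And>L1 L2. L1 \<in> bigraded 0 1 \<Longrightarrow> L2 \<in> bigraded 0 1 \<Longrightarrow> det A = L1 * L2 \<Longrightarrow>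
      {P. embedded_prime I P} = {st_prime L1, st_prime L2}"
proof -
  from assms obtain a b c d s' t' B where A: "\<forall>i j. A $ i $ j \<in> bigraded 0 1"
    and D: "a * d - b * c \<noteq> 0"
    and st: "s' = Const a * Var S + Const b * Var T" "t' = Const c * Var S + Const d * Var T"
    and B: "B = [s'\<^sup>2 * Var U, s'\<^sup>2 * Var V,
              s' * t' * A $ 1 $ 1 + t'\<^sup>2 * A $ 1 $ 2,
              s' * t' * A $ 2 $ 1 + t'\<^sup>2 * A $ 2 $ 2] \<or>
         B = [s' * t' * Var U, s' * t' * Var V,
              s'\<^sup>2 * A $ 1 $ 1 + t'\<^sup>2 * A $ 1 $ 2,
              s'\<^sup>2 * A $ 2 $ 1 + t'\<^sup>2 * A $ 2 $ 2]"
    and span: "kspace.span (set B) = W"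
    unfolding normal_form_matrix_def kscale_def by blast
  obtain a1 b1 a2 b2 a3 b3 a4 b4 where l: "A $ 1 $ 1 = uv_form a1 b1" "A $ 1 $ 2 = uv_form a2 b2"
      "A $ 2 $ 1 = uv_form a3 b3" "A $ 2 $ 2 = uv_form a4 b4"
    using A by (metis bigraded_0_1_iff)
  have det: "det A = uv_form a1 b1 * uv_form a4 b4 - uv_form a2 b2 * uv_form a3 b3"
    by (simp add: det_2 l)
  have I_B: "I = ideal.span (set B)"
    using span ideal_span_kspan[of "set B"] ideal_span_kspan[of "p ` {..<4}"] by (simp add: I_def W_def)
  let ?\<Theta> = "pol_of_bipoly s' t'"
  have \<Theta>: "unital_hom ?\<Theta>"
    by (rule unital_hom_pol_of_bipoly)
  have bij: "bij ?\<Theta>"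
    by (rule bij_pol_of_bipoly[OF D st])
  have \<Theta>_bimonom: "?\<Theta> (bimonom i j (linform x y)) = s' ^ i * t' ^ j * uv_form x y" for i j x y
    by (simp add: pol_of_bipoly_bimonom uv_pol_linform)
  have Var_uv: "Var U = uv_form 1 (0 :: 'k)" "Var V = uv_form 0 (1 :: 'k)"
    by (fact Var_eq_uv_form)+
  have nz: "s' \<noteq> 0" "t' \<noteq> 0"
    using D unfolding st by (auto intro!: st_form_neq_0)
  define D' where "D' = a * d - b * c"
  have D'0: "D' \<noteq> 0" using D by (simp add: D'_def)
  \<comment> \<open>The point is the second column of the inverse matrix, so that
    \<open>s' = 0\<close> and \<open>t' = 1\<close>; the first column is used below as a zero of
    \<open>t'\<close>.\<close>
  have eval_s: "eval_pol \<sigma> s' = 0" "eval_pol \<sigma> t' = 1" if "\<sigma> S = - b / D'" "\<sigma> T = a / D'" for \<sigma>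
    using D'0 by (simp_all add: st eval_pol_simps that divide_simps) (simp_all add: D'_def algebra_simps)
  have eval_t: "eval_pol \<sigma> t' = 0" if "\<sigma> S = d / D'" "\<sigma> T = - c / D'" for \<sigma>
    using D'0 by (simp add: st eval_pol_simps that divide_simps)
  have ab: "(- b / D', a / D') \<noteq> (0, 0)" and cd: "(d / D', - c / D') \<noteq> (0, 0)"
    using D D'0 by auto
  \<comment> \<open>The values at \<open>U\<close> and \<open>V\<close> are arbitrary: this point is
    used to evaluate forms in \<open>s', t'\<close> alone.\<close>
  define \<sigma> where "\<sigma> x = (case x of S \<Rightarrow> - b / D' | T \<Rightarrow> a / D' | U \<Rightarrow> 0 | V \<Rightarrow> 0)" for x
  have \<sigma>: "eval_pol \<sigma> s' = 0" "eval_pol \<sigma> t' = 1"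
    using eval_s[of \<sigma>] by (simp_all add: \<sigma>_def)
  have m: "{x. bicoeff x 0 0 = 0} = ideal.span {linform 1 0, linform 0 (1 :: 'k)}"
    by (rule span_linforms[symmetric]) simp
  have image: "{P. embedded_prime (?\<Theta> ` J) P} = {st_prime (uv_form x1 y1), st_prime (uv_form x2 y2)}"
    if "{P. embedded_prime J P} = {{g. linform x1 y1 dvd bicoeff g 0 0}, {g. linform x2 y2 dvd bicoeff g 0 0}}"
    for J x1 y1 x2 y2
    unfolding embedded_primes_image[OF \<Theta> bij] that by (simp add: st_prime_image[OF D st])
  from B have "det A \<noteq> 0 \<and> (\<forall>x1 y1 x2 y2. det A = uv_form x1 y1 * uv_form x2 y2 \<longrightarrow>
      {P. embedded_prime I P} = {st_prime (uv_form x1 y1), st_prime (uv_form x2 y2)})"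
  proof
    assume "B = [s'\<^sup>2 * Var U, s'\<^sup>2 * Var V,
              s' * t' * A $ 1 $ 1 + t'\<^sup>2 * A $ 1 $ 2,
              s' * t' * A $ 2 $ 1 + t'\<^sup>2 * A $ 2 $ 2]"
    then have setB: "set B = {s'\<^sup>2 * Var U, s'\<^sup>2 * Var V,
        s' * t' * uv_form a1 b1 + t'\<^sup>2 * uv_form a2 b2, s' * t' * uv_form a3 b3 + t'\<^sup>2 * uv_form a4 b4}"
      by (simp add: l)
    \<comment> \<open>On \<open>s' = 0\<close> both \<open>s'^2\<close> and \<open>s' t'\<close>
      vanish, leaving only the terms \<open>t'^2\<close> with the second column.\<close>
    have D24: "a2 * b4 - b2 * a4 \<noteq> 0"
      using span ab unfolding setB
      by (intro forms_independent[where h = "s'\<^sup>2" and e = "s' * t'" and e' = "t'\<^sup>2" and s = "- b / D'" and t = "a / D'"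
          and f = "uv_form a1 b1" and g = "uv_form a3 b3"])
         (simp_all add: eval_pol_simps eval_s)
    have "det A \<noteq> 0"
      unfolding det using span nz unfolding setB
      by (intro forms_det_nonzero[where h = "s'\<^sup>2" and e = "s' * t'" and e' = "t'\<^sup>2" and \<sigma> = \<sigma>] D24)
         (simp_all add: eval_pol_simps \<sigma> power2_eq_square pol_mult_eq_0_iff)
    moreover have "{P. embedded_prime I P} = {st_prime (uv_form x1 y1), st_prime (uv_form x2 y2)}"
      if "det A = uv_form x1 y1 * uv_form x2 y2" for x1 y1 x2 y2
    proof -
      have "(x1, y1) \<noteq> (0, 0)" "(x2, y2) \<noteq> (0, 0)"
        using \<open>det A \<noteq> 0\<close> that by (auto simp: uv_form_0)
      moreover have "uv_pol (linform a1 b1 * linform a4 b4 - linform a2 b2 * linform a3 b3) =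
          uv_pol (linform x1 y1 * linform x2 y2)"
        using that unfolding det by (simp add: unital_homD[OF unital_hom_uv_pol] uv_pol_linform)
      then have "linform a1 b1 * linform a4 b4 - linform a2 b2 * linform a3 b3 = linform x1 y1 * linform x2 y2"
        by (rule injD[OF inj_uv_pol])
      ultimately interpret form_ideal "linform a1 b1" "linform a2 b2" "linform a3 b3" "linform a4 b4"
        "linform x1 y1" "linform x2 y2" "{x. bicoeff x 0 0 = 0}" 1 1 0 2
        using D24 by (intro form_ideal_linforms) simp_all
      have "I = ideal.span (?\<Theta> ` {bimonom 2 0 (linform 1 0), bimonom 2 0 (linform 0 1),
          bimonom 1 1 (linform a1 b1) + bimonom 0 2 (linform a2 b2),
          bimonom 1 1 (linform a3 b3) + bimonom 0 2 (linform a4 b4)})"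
        unfolding I_B setB Var_uv by (simp add: \<Theta>_bimonom unital_homD[OF \<Theta>])
      also have "\<dots> = ?\<Theta> ` J"
        by (simp only: ideal_span_image[OF \<Theta> bij_is_surj[OF bij]]
            span_eq_J_square[OF refl refl refl refl m span_linforms[OF D24, symmetric]])
      finally show ?thesis
        by (simp only: image[OF embedded_primes])
    qed
    ultimately show ?thesis by blast
  next
    assume "B = [s' * t' * Var U, s' * t' * Var V,
              s'\<^sup>2 * A $ 1 $ 1 + t'\<^sup>2 * A $ 1 $ 2,
              s'\<^sup>2 * A $ 2 $ 1 + t'\<^sup>2 * A $ 2 $ 2]"
    then have setB: "set B = {s' * t' * Var U, s' * t' * Var V,
        s'\<^sup>2 * uv_form a1 b1 + t'\<^sup>2 * uv_form a2 b2, s'\<^sup>2 * uv_form a3 b3 + t'\<^sup>2 * uv_form a4 b4}"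
      by (simp add: l)
    have D24: "a2 * b4 - b2 * a4 \<noteq> 0"
      using span ab unfolding setB
      by (intro forms_independent[where h = "s' * t'" and e = "s'\<^sup>2" and e' = "t'\<^sup>2" and s = "- b / D'" and t = "a / D'"
          and f = "uv_form a1 b1" and g = "uv_form a3 b3"])
         (simp_all add: eval_pol_simps eval_s)
    \<comment> \<open>The summands are exchanged so that the same criterion, now applied at a zero
      of \<open>t'\<close>, treats the first column.\<close>
    have setB': "set B = {s' * t' * Var U, s' * t' * Var V,
        t'\<^sup>2 * uv_form a2 b2 + s'\<^sup>2 * uv_form a1 b1, t'\<^sup>2 * uv_form a4 b4 + s'\<^sup>2 * uv_form a3 b3}"
      unfolding setB by (simp only: add.commute)
    have D13: "a1 * b3 - b1 * a3 \<noteq> 0"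
      using span cd unfolding setB'
      by (intro forms_independent[where h = "s' * t'" and e = "t'\<^sup>2" and e' = "s'\<^sup>2" and s = "d / D'" and t = "- c / D'"
          and f = "uv_form a2 b2" and g = "uv_form a4 b4"])
         (simp_all add: eval_pol_simps eval_t)
    have "det A \<noteq> 0"
      unfolding det using span nz unfolding setB
      by (intro forms_det_nonzero[where h = "s' * t'" and e = "s'\<^sup>2" and e' = "t'\<^sup>2" and \<sigma> = \<sigma>] D24)
         (simp_all add: eval_pol_simps \<sigma> power2_eq_square pol_mult_eq_0_iff)
    moreover have "{P. embedded_prime I P} = {st_prime (uv_form x1 y1), st_prime (uv_form x2 y2)}"
      if "det A = uv_form x1 y1 * uv_form x2 y2" for x1 y1 x2 y2
    proof -
      have "(x1, y1) \<noteq> (0, 0)" "(x2, y2) \<noteq> (0, 0)"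
        using \<open>det A \<noteq> 0\<close> that by (auto simp: uv_form_0)
      moreover have "uv_pol (linform a1 b1 * linform a4 b4 - linform a2 b2 * linform a3 b3) =
          uv_pol (linform x1 y1 * linform x2 y2)"
        using that unfolding det by (simp add: unital_homD[OF unital_hom_uv_pol] uv_pol_linform)
      then have "linform a1 b1 * linform a4 b4 - linform a2 b2 * linform a3 b3 = linform x1 y1 * linform x2 y2"
        by (rule injD[OF inj_uv_pol])
      ultimately interpret form_ideal "linform a1 b1" "linform a2 b2" "linform a3 b3" "linform a4 b4"
        "linform x1 y1" "linform x2 y2" "{x. bicoeff x 0 0 = 0}" 2 0 0 2
        using D24 by (intro form_ideal_linforms) simp_all
      have "I = ideal.span (?\<Theta> ` {bimonom 1 1 (linform 1 0), bimonom 1 1 (linform 0 1),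
          bimonom 2 0 (linform a1 b1) + bimonom 0 2 (linform a2 b2),
          bimonom 2 0 (linform a3 b3) + bimonom 0 2 (linform a4 b4)})"
        unfolding I_B setB Var_uv by (simp add: \<Theta>_bimonom unital_homD[OF \<Theta>])
      also have "\<dots> = ?\<Theta> ` J"
        by (simp only: ideal_span_image[OF \<Theta> bij_is_surj[OF bij]]
            span_eq_J_split[OF refl refl refl refl m span_linforms[OF D13, symmetric] span_linforms[OF D24, symmetric]])
      finally show ?thesis
        by (simp only: image[OF embedded_primes])
    qed
    ultimately show ?thesis by blast
  qed
  then show "det A \<noteq> 0" "\<And>L1 L2. L1 \<in> bigraded 0 1 \<Longrightarrow> L2 \<in> bigraded 0 1 \<Longrightarrow> det A = L1 * L2 \<Longrightarrow>
      {P. embedded_prime I P} = {st_prime L1, st_prime L2}"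
    by (blast, metis bigraded_0_1_iff)
qed

end

lemma det_factorization:
  fixes A :: "'k::alg_closed_field pol ^ 2 ^ 2"
  assumes "\<And>i j. A $ i $ j \<in> bigraded 0 1"
  obtains L1 L2 where "L1 \<in> bigraded 0 1" "L2 \<in> bigraded 0 1" "det A = L1 * L2"
proof -
  obtain a1 b1 a2 b2 a3 b3 a4 b4 where l: "A $ 1 $ 1 = uv_form a1 b1" "A $ 1 $ 2 = uv_form a2 b2"
      "A $ 2 $ 1 = uv_form a3 b3" "A $ 2 $ 2 = uv_form a4 b4"
    using assms by (metis bigraded_0_1_iff)
  obtain x y z w where f: "a1 * a4 - a2 * a3 = x * z"
    "a1 * b4 + b1 * a4 - (a2 * b3 + b2 * a3) = x * w + y * z" "b1 * b4 - b2 * b3 = y * w"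
    by (rule binary_quadratic_factorization)
  have mult: "uv_form a b * uv_form c d =
      Const (a * c) * (Var U)\<^sup>2 + Const (a * d + b * c) * (Var U * Var V) + Const (b * d) * (Var V)\<^sup>2"
    for a b c d :: 'k
    unfolding uv_form_def Const_simps(2,3) by (simp only: power2_eq_square algebra_simps)
  have "det A = Const (a1 * a4 - a2 * a3) * (Var U)\<^sup>2 +
      Const (a1 * b4 + b1 * a4 - (a2 * b3 + b2 * a3)) * (Var U * Var V) + Const (b1 * b4 - b2 * b3) * (Var V)\<^sup>2"
    unfolding det_2 l mult Const_simps(6) by (simp only: algebra_simps)
  also have "\<dots> = uv_form x y * uv_form z w"
    unfolding f mult ..
  finally show thesis
    using that uv_form_bigraded by blast
qed

theorem corollary3p5:
  fixes p :: "nat \<Rightarrow> 'k::alg_closed_field pol"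
    and W I :: "'k pol set"
  assumes W_def: "W = kspace.span (p ` {..<4})"
    and W_bidegree: "W \<subseteq> bigraded 2 1"
    and W_dim: "kspace.dim W = 4"
    and I_def: "I = ideal.span (p ` {..<4})"
    and bpf: "basepoint_free p"
    and syz: "unique_first_syzygy p 0 1"
  shows "card {P. embedded_prime I P \<and> (\<exists>L \<in> bigraded 0 1. P = st_prime L)} \<in> {1, 2}
    \<and> (\<exists>A. normal_form_matrix W A)
    \<and> (\<forall>A. normal_form_matrix W A \<longrightarrow>
          det A \<noteq> 0
        \<and> (\<exists>L1 \<in> bigraded 0 1. \<exists>L2 \<in> bigraded 0 1. det A = L1 * L2)
        \<and> (\<forall>L1 \<in> bigraded 0 1. \<forall>L2 \<in> bigraded 0 1. det A = L1 * L2 \<longrightarrow>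
              (associated_up_to_scalar L1 L2 \<longrightarrow>
                 {P. embedded_prime I P} = {st_prime L1})
            \<and> (\<not> associated_up_to_scalar L1 L2 \<longrightarrow>
                 {P. embedded_prime I P} = {st_prime L1, st_prime L2}
                 \<and> st_prime L1 \<noteq> st_prime L2)))"
proof -
  interpret linear_syzygy_surface p W I
    by (rule linear_syzygy_surface.intro) (fact assms)+
  have fact: "\<exists>L1 \<in> bigraded 0 1. \<exists>L2 \<in> bigraded 0 1. det A = L1 * L2" if "normal_form_matrix W A" for A
    using that det_factorization[of A] unfolding normal_form_matrix_def by metis
  obtain A where A: "normal_form_matrix W A"
    using exists_normal_form by blast
  obtain L1 L2 where L: "L1 \<in> bigraded 0 1" "L2 \<in> bigraded 0 1" "det A = L1 * L2"
    using fact[OF A] by blast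
  have "{P. embedded_prime I P \<and> (\<exists>L \<in> bigraded 0 1. P = st_prime L)} = {st_prime L1, st_prime L2}"
    using normal_form_embedded(2)[OF A L] L(1,2) by blast
  \<comment> \<open>The set has one or two elements according to whether the two primes
    coincide.\<close>
  then have card: "card {P. embedded_prime I P \<and> (\<exists>L \<in> bigraded 0 1. P = st_prime L)} \<in> {1, 2}"
    by (simp add: card_insert_if)
  have "(associated_up_to_scalar L1 L2 \<longrightarrow> {P. embedded_prime I P} = {st_prime L1})
      \<and> (\<not> associated_up_to_scalar L1 L2 \<longrightarrow>
           {P. embedded_prime I P} = {st_prime L1, st_prime L2} \<and> st_prime L1 \<noteq> st_prime L2)"
    if A: "normal_form_matrix W A" and L: "L1 \<in> bigraded 0 1" "L2 \<in> bigraded 0 1" "det A = L1 * L2" for A L1 L2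
  proof -
    have "L1 \<noteq> 0" "L2 \<noteq> 0"
      using normal_form_embedded(1)[OF A] L(3) by auto
    then show ?thesis
      using st_prime_eq_iff[OF L(1,2)] normal_form_embedded(2)[OF A L] by auto
  qed
  then show ?thesis
    using card exists_normal_form normal_form_embedded(1) fact by simp
qed

end
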